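(* For every positive integer $k$, in $\mathbb C[[\mathbf r,\mathbf t]]$, \[ \sum_{n\ge0}\frac1{|B_n|}\sum_{\underline\mu\vdash n}\sum_{y\in C_{\underline\mu}}\sum_{\underline\lambda\vdash n}\sum_{\substack{x\in C_{\underline\lambda}\\ x^k=y}}\prod_{\ell,\varepsilon}r_{\ell,\varepsilon}^{\ell m_{\ell,\varepsilon}}\prod_{j,\theta}t_{j,\theta}^{jb_{j,\theta}} =\exp\Big(\sum_{j,\theta}\sum_{\substack{h\mid k\\ \gcd(h,j)=1}}\frac{t_{j,\theta}^{jk/h}}{2jk/h}\sum_{\varepsilon\in R_{h,\theta}}r_{jk/h,\varepsilon}^{jk/h}\Big), \] where $R_{h,\theta}=\{\varepsilon\in\mathbb Z_2:\varepsilon^h=\theta\}$, $\underline\lambda$ has $m_{\ell,\varepsilon}$ cycles of length $\ell$ and class $\varepsilon$, and $\underline\mu$ has $b_{j,\theta}$ cycles of length $j$ and class $\theta$.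
   Context: $B_n$ is the group of bijections $w$ of $\{\pm1,\dots,\pm n\}$ with $w(-i)=-w(i)$. Cycles: if $c=(a_1,\dots,a_\ell)$ is a cycle of $w$ on $\{\pm1,\dots,\pm n\}$ so is $\bar c$ (negated entries); if $c\ne\bar c$, $c\bar c$ is a cycle of length $\ell$ and $\mathbb Z_2$-class $+1$; if $c=\bar c$, a cycle of length $\ell/2$ and class $-1$. $C_{\underline\lambda}$ is the conjugacy class of elements of signed cycle type $\underline\lambda=(\lambda^+,\lambda^-)\vdash n$ ($\lambda^\varepsilon$ lists lengths of cycles of class $\varepsilon$). $\mathbb Z_2=\{\pm1\}$; $\mathbf r=(r_{\ell,\varepsilon})$, $\mathbf t=(t_{j,\theta})$ ($\ell,j\ge1$, $\varepsilon,\theta\in\mathbb Z_2$) are indeterminates; $h$ runs over positive divisors of $k$. *)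

theory Defs
  imports Complex_Main "HOL-Library.Multiset" "HOL-Library.Poly_Mapping"
    "HOL-Combinatorics.Permutations" "HOL-Combinatorics.Orbits"
begin

section \<open>Formal power series in arbitrarily many indeterminates\<close>

text \<open>
  For a type \<open>'v\<close> of indeterminates, the monomials are the finitely supported exponent functions
  \<open>'v \<Rightarrow>\<^sub>0 nat\<close>; a power series with coefficients in \<open>'a\<close> is an arbitrary function from monomials
  to \<open>'a\<close>.
\<close>

typedef ('v, 'a) mps = "UNIV :: (('v \<Rightarrow>\<^sub>0 nat) \<Rightarrow> 'a) set"
  morphisms coeff Abs_mps by simp

setup_lifting type_definition_mps

lemma mps_eqI: "(\<And>m. coeff f m = coeff g m) \<Longrightarrow> f = g"
  by transfer auto

definition splits :: "('v \<Rightarrow>\<^sub>0 nat) \<Rightarrow> (('v \<Rightarrow>\<^sub>0 nat) \<times> ('v \<Rightarrow>\<^sub>0 nat)) set" where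
  "splits m = {(a, b). a + b = m}"

lemma finite_splits: "finite (splits m)"
proof -
  define A where "A = {a. \<exists>b. a + b = m}"
  have *: "Poly_Mapping.lookup a x \<le> Poly_Mapping.lookup m x" if "a \<in> A" for a x
    using that by (auto simp: A_def lookup_add)
  have "Poly_Mapping.lookup ` A \<subseteq> {f. \<forall>x. (x \<in> Poly_Mapping.keys m \<longrightarrow> f x \<in> {..(\<Sum>y\<in>Poly_Mapping.keys m. Poly_Mapping.lookup m y)}) \<and>
      (x \<notin> Poly_Mapping.keys m \<longrightarrow> f x = 0)}"
  proof (intro image_subsetI CollectI allI conjI impI)
    fix a x assume a: "a \<in> A"
    { assume "x \<in> Poly_Mapping.keys m"
      then have "Poly_Mapping.lookup m x \<le> (\<Sum>y\<in>Poly_Mapping.keys m. Poly_Mapping.lookup m y)"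
        by (intro member_le_sum) auto
      with *[OF a, of x]
      show "Poly_Mapping.lookup a x \<in> {..(\<Sum>y\<in>Poly_Mapping.keys m. Poly_Mapping.lookup m y)}"
        by simp }
    { assume "x \<notin> Poly_Mapping.keys m"
      with *[OF a, of x] show "Poly_Mapping.lookup a x = 0" by (simp add: in_keys_iff) }
  qed
  moreover have "finite \<dots>"
    by (rule finite_set_of_finite_funs) auto
  ultimately have "finite (Poly_Mapping.lookup ` A)" by (rule finite_subset)
  then have "finite A"
    by (rule finite_imageD) (simp add: inj_on_def)
  moreover have "splits m \<subseteq> A \<times> A"
    unfolding splits_def A_def using add.commute by fast
  ultimately show ?thesis by (meson finite_SigmaI finite_subset)
qed

instantiation mps :: (type, comm_ring_1) comm_ring_1
begin

lift_definition zero_mps :: "('a, 'b) mps" is "\<lambda>_. 0" .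
lift_definition one_mps :: "('a, 'b) mps" is "\<lambda>m. if m = 0 then 1 else 0" .
lift_definition plus_mps :: "('a, 'b) mps \<Rightarrow> ('a, 'b) mps \<Rightarrow> ('a, 'b) mps"
  is "\<lambda>f g m. f m + g m" .
lift_definition minus_mps :: "('a, 'b) mps \<Rightarrow> ('a, 'b) mps \<Rightarrow> ('a, 'b) mps"
  is "\<lambda>f g m. f m - g m" .
lift_definition uminus_mps :: "('a, 'b) mps \<Rightarrow> ('a, 'b) mps"
  is "\<lambda>f m. - f m" .
lift_definition times_mps :: "('a, 'b) mps \<Rightarrow> ('a, 'b) mps \<Rightarrow> ('a, 'b) mps"
  is "\<lambda>f g m. \<Sum>(a, b)\<in>splits m. f a * g b" .

instance
proof
  fix f g h :: "('a, 'b) mps"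
  show "f + g + h = f + (g + h)" by transfer (simp add: add.assoc)
  show "f + g = g + f" by transfer (simp add: add.commute)
  show "0 + f = f" by transfer simp
  show "- f + f = 0" by transfer simp
  show "f - g = f + - g" by transfer simp
  show "(0 :: ('a, 'b) mps) \<noteq> 1" by transfer (auto simp: fun_eq_iff)
  show "(f + g) * h = f * h + g * h"
    by transfer (simp add: distrib_right sum.distrib case_prod_unfold)
  show "f * g = g * f"
  proof (transfer, rule ext)
    fix f g :: "('a \<Rightarrow>\<^sub>0 nat) \<Rightarrow> 'b" and m
    show "(\<Sum>(a, b)\<in>splits m. f a * g b) = (\<Sum>(a, b)\<in>splits m. g a * f b)"
      by (rule sum.reindex_bij_witness[of _ prod.swap prod.swap])
        (auto simp: splits_def add.commute mult.commute)
  qed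
  show "1 * f = f"
  proof (transfer, rule ext)
    fix f :: "('a \<Rightarrow>\<^sub>0 nat) \<Rightarrow> 'b" and m
    have "(\<Sum>(a, b)\<in>splits m. (if a = 0 then 1 else 0) * f b)
        = (\<Sum>(a, b)\<in>{(0 :: 'a \<Rightarrow>\<^sub>0 nat, m)}. (if a = 0 then 1 else 0) * f b)"
      proof (rule sum.mono_neutral_right)
      show "finite (splits m)" by (rule finite_splits)
      show "{(0, m)} \<subseteq> splits m" by (simp add: splits_def)
      show "\<forall>i\<in>splits m - {(0, m)}. (case i of (a, b) \<Rightarrow> (if a = 0 then 1 else 0) * f b) = 0"
        by (auto simp: splits_def split: if_splits)
    qed
    then show "(\<Sum>(a, b)\<in>splits m. (if a = 0 then 1 else 0) * f b) = f m" by simp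
  qed
  show "f * g * h = f * (g * h)"
  proof (transfer, rule ext)
    fix f g h :: "('a \<Rightarrow>\<^sub>0 nat) \<Rightarrow> 'b" and m
    have "(\<Sum>(p, c)\<in>splits m. (\<Sum>(a, b)\<in>splits p. f a * g b) * h c)
        = (\<Sum>p\<in>splits m. \<Sum>q\<in>splits (fst p). f (fst q) * g (snd q) * h (snd p))"
      by (simp add: case_prod_unfold sum_distrib_right)
    also have "\<dots> = (\<Sum>(p, q)\<in>(SIGMA p:splits m. splits (fst p)). f (fst q) * g (snd q) * h (snd p))"
      by (rule sum.Sigma) (auto simp: finite_splits)
    also have "\<dots> = (\<Sum>(p, q)\<in>(SIGMA p:splits m. splits (snd p)). f (fst p) * (g (fst q) * h (snd q)))"
      by (rule sum.reindex_bij_witness[of _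
            "\<lambda>(p, q). ((fst p + fst q, snd q), (fst p, fst q))"
            "\<lambda>(p, q). ((fst q, snd q + snd p), (snd q, snd p))"])
        (auto simp: splits_def algebra_simps)
    also have "\<dots> = (\<Sum>p\<in>splits m. \<Sum>q\<in>splits (snd p). f (fst p) * (g (fst q) * h (snd q)))"
      by (rule sum.Sigma[symmetric]) (auto simp: finite_splits)
    also have "\<dots> = (\<Sum>(a, p)\<in>splits m. f a * (\<Sum>(b, c)\<in>splits p. g b * h c))"
      by (simp add: case_prod_unfold sum_distrib_left)
    finally show "(\<Sum>(p, c)\<in>splits m. (\<Sum>(a, b)\<in>splits p. f a * g b) * h c)
        = (\<Sum>(a, p)\<in>splits m. f a * (\<Sum>(b, c)\<in>splits p. g b * h c))" .
  qed
qed

end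

lift_definition mps_const :: "'a::zero \<Rightarrow> ('v, 'a) mps"
  is "\<lambda>c m. if m = 0 then c else 0" .

lift_definition mps_var :: "'v \<Rightarrow> ('v, 'a::zero_neq_one) mps"
  is "\<lambda>v m. if m = Poly_Mapping.single v 1 then 1 else 0" .

text \<open>
  Infinite sums are formal: each coefficient must receive only finitely many nonzero
  contributions. On families that are not summable the value of \<open>mps_sum\<close> is meaningless.
\<close>

definition mps_summable :: "('i \<Rightarrow> ('v, 'a::comm_monoid_add) mps) \<Rightarrow> 'i set \<Rightarrow> bool" where
  "mps_summable f A \<longleftrightarrow> (\<forall>m. finite {i \<in> A. coeff (f i) m \<noteq> 0})"

lift_definition mps_sum :: "('i \<Rightarrow> ('v, 'a::comm_monoid_add) mps) \<Rightarrow> 'i set \<Rightarrow> ('v, 'a) mps"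
  is "\<lambda>f A m. \<Sum>i | i \<in> A \<and> f i m \<noteq> 0. f i m" .

text \<open>Meaningful for series with vanishing constant term, see \<open>mps_exp_summable\<close> below.\<close>

definition mps_exp :: "('v, 'a::field_char_0) mps \<Rightarrow> ('v, 'a) mps" where
  "mps_exp f = mps_sum (\<lambda>n. mps_const (1 / fact n) * f ^ n) UNIV"

section \<open>Hyperoctahedral groups\<close>

typedef Z2 = "{1, -1 :: int}" by auto

setup_lifting type_definition_Z2

instantiation Z2 :: "{comm_monoid_mult, uminus}"
begin
lift_definition one_Z2 :: Z2 is 1 by simp
lift_definition times_Z2 :: "Z2 \<Rightarrow> Z2 \<Rightarrow> Z2" is "(*)" by auto
lift_definition uminus_Z2 :: "Z2 \<Rightarrow> Z2" is uminus by auto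
instance by standard (transfer; simp)+
end

lemma UNIV_Z2: "(UNIV :: Z2 set) = {1, -1}"
  by (auto, transfer, auto)

instance Z2 :: finite
  by standard (simp add: UNIV_Z2)

definition pm_set :: "nat \<Rightarrow> int set" where
  "pm_set n = {- int n..int n} - {0}"

text \<open>Elements of \<open>hyperoct n\<close> are extended by the identity outside \<open>pm_set n\<close>.\<close>

definition hyperoct :: "nat \<Rightarrow> (int \<Rightarrow> int) set" where
  "hyperoct n = {w. w permutes pm_set n \<and> (\<forall>i\<in>pm_set n. w (- i) = - w i)}"

text \<open>
  A cycle of \<open>w\<close> is recorded by its set of entries, which determines the cycle since \<open>w\<close> is given.
  The negation of a cycle \<open>c\<close> is \<open>uminus ` c\<close>.
\<close>

definition cycles_of :: "nat \<Rightarrow> (int \<Rightarrow> int) \<Rightarrow> int set set" where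
  "cycles_of n w = orbit w ` pm_set n"

text \<open>
  The number of cycles of length \<open>l\<close> and class \<open>e\<close>. A cycle of class \<open>1\<close> is an unordered pair of
  distinct mutually negative cycles on \<open>pm_set n\<close>, each with \<open>l\<close> entries; a cycle of class \<open>-1\<close> is
  a self-negative cycle on \<open>pm_set n\<close>, with \<open>2 * l\<close> entries.
\<close>

definition num_cycles :: "nat \<Rightarrow> (int \<Rightarrow> int) \<Rightarrow> nat \<Rightarrow> Z2 \<Rightarrow> nat" where
  "num_cycles n w l e =
    (if e = 1
     then card {{c, uminus ` c} |c. c \<in> cycles_of n w \<and> c \<noteq> uminus ` c \<and> card c = l}
     else card {c \<in> cycles_of n w. c = uminus ` c \<and> card c = 2 * l})"

text \<open>
  Pairs of partitions \<open>(la 1, la (-1))\<close> of total size \<open>n\<close>; a partition is the multiset of its parts.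
\<close>

definition bipartitions :: "nat \<Rightarrow> (Z2 \<Rightarrow> nat multiset) set" where
  "bipartitions n = {la. (\<forall>e. 0 \<notin># la e) \<and> (\<Sum>e\<in>UNIV. \<Sum>\<^sub># (la e)) = n}"

text \<open>The elements of \<open>hyperoct n\<close> of signed cycle type \<open>la\<close>.\<close>

definition conj_class :: "nat \<Rightarrow> (Z2 \<Rightarrow> nat multiset) \<Rightarrow> (int \<Rightarrow> int) set" where
  "conj_class n la = {w \<in> hyperoct n. \<forall>l e. num_cycles n w l e = count (la e) l}"

definition root_signs :: "nat \<Rightarrow> Z2 \<Rightarrow> Z2 set" where
  "root_signs h th = {e. e ^ h = th}"

section \<open>The indeterminates\<close>

text \<open>The indeterminates with first index \<open>0\<close> exist for convenience only and are never used.\<close>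

datatype indet = R nat Z2 | T nat Z2

type_synonym rt_series = "(indet, complex) mps"

definition r_var :: "nat \<Rightarrow> Z2 \<Rightarrow> rt_series" where
  "r_var l e = mps_var (R l e)"

definition t_var :: "nat \<Rightarrow> Z2 \<Rightarrow> rt_series" where
  "t_var j th = mps_var (T j th)"

section \<open>Well-definedness\<close>

text \<open>The index sets of the inner sums, and the supports of the infinite products, are finite.\<close>

lemma finite_bipartitions: "finite (bipartitions n)"
proof -
  define P where "P = {M :: nat multiset. 0 \<notin># M \<and> \<Sum>\<^sub># M \<le> n}"
  have size_le: "size M \<le> \<Sum>\<^sub># M" if "0 \<notin># M" for M :: "nat multiset"
    using that by (induction M) auto
  have "P \<subseteq> mset ` {xs. set xs \<subseteq> {..n} \<and> length xs \<le> n}"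
  proof
    fix M assume M: "M \<in> P"
    obtain xs where xs: "M = mset xs" by (metis ex_mset)
    have "x \<le> n" if x: "x \<in># M" for x
    proof -
      obtain N where "M = add_mset x N" using multi_member_split[OF x] by blast
      then have "x \<le> \<Sum>\<^sub># M" by simp
      then show ?thesis using M by (simp add: P_def)
    qed
    moreover have "size M \<le> n" using size_le[of M] M by (auto simp: P_def)
    ultimately have "set xs \<subseteq> {..n} \<and> length xs \<le> n"
      by (auto simp: xs)
    then show "M \<in> mset ` {xs. set xs \<subseteq> {..n} \<and> length xs \<le> n}"
      using xs by blast
  qed
  then have "finite P"
    by (rule finite_subset) (intro finite_imageI finite_lists_length_le, simp)
  then have "finite {la :: Z2 \<Rightarrow> nat multiset. \<forall>x. (x \<in> UNIV \<longrightarrow> la x \<in> P) \<and> (x \<notin> UNIV \<longrightarrow> la x = {#})}"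
    by (intro finite_set_of_finite_funs) auto
  moreover have "\<Sum>\<^sub># (la e) \<le> (\<Sum>e\<in>UNIV. \<Sum>\<^sub># (la e))" for la :: "Z2 \<Rightarrow> nat multiset" and e
    by (rule member_le_sum) auto
  then have "bipartitions n \<subseteq>
      {la. \<forall>x. (x \<in> UNIV \<longrightarrow> la x \<in> P) \<and> (x \<notin> UNIV \<longrightarrow> la x = {#})}"
    unfolding bipartitions_def P_def by auto
  ultimately show ?thesis using finite_subset by blast
qed

lemma finite_hyperoct: "finite (hyperoct n)"
  by (rule finite_subset[OF _ finite_permutations[of "pm_set n"]])
    (auto simp: hyperoct_def pm_set_def)

lemma finite_conj_class: "finite (conj_class n la)"
  by (rule finite_subset[OF _ finite_hyperoct[of n]]) (auto simp: conj_class_def)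

lemma finite_weight_support:
  "finite {(l, e). f l e ^ (l * count (la e) l) \<noteq> (1 :: rt_series)}" for la :: "Z2 \<Rightarrow> nat multiset"
proof (rule finite_subset)
  show "{(l, e). f l e ^ (l * count (la e) l) \<noteq> (1 :: rt_series)}
      \<subseteq> (\<Union>e. set_mset (la e)) \<times> UNIV"
  proof safe
    fix l e assume *: "f l e ^ (l * count (la e) l) \<noteq> (1 :: rt_series)"
    have "count (la e) l \<noteq> 0"
    proof
      assume "count (la e) l = 0"
      with * show False by simp
    qed
    then show "l \<in> (\<Union>e. set_mset (la e))" by (auto simp: count_eq_zero_iff)
  qed simp
qed simp

text \<open>
  The families of power series summed in the main statement are summable; for the outer sum this
  holds because its \<open>n\<close>-th term is homogeneous of degree \<open>2 * n\<close>.
\<close>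

definition mdeg :: "('v \<Rightarrow>\<^sub>0 nat) \<Rightarrow> nat" where
  "mdeg m = (\<Sum>v\<in>Poly_Mapping.keys m. Poly_Mapping.lookup m v)"

lemma mdeg_superset:
  "finite S \<Longrightarrow> Poly_Mapping.keys m \<subseteq> S \<Longrightarrow> mdeg m = (\<Sum>v\<in>S. Poly_Mapping.lookup m v)"
  unfolding mdeg_def by (rule sum.mono_neutral_left) (auto simp: in_keys_iff)

lemma mdeg_add: "mdeg (a + b) = mdeg a + mdeg b"
proof -
  let ?S = "Poly_Mapping.keys a \<union> Poly_Mapping.keys b"
  have "mdeg (a + b) = (\<Sum>v\<in>?S. Poly_Mapping.lookup (a + b) v)"
    by (rule mdeg_superset) (use keys_add[of a b] in auto)
  also have "\<dots> = mdeg a + mdeg b"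
    by (simp add: lookup_add sum.distrib mdeg_superset[of ?S a] mdeg_superset[of ?S b])
  finally show ?thesis .
qed

lemma mdeg_zero [simp]: "mdeg 0 = 0"
  by (simp add: mdeg_def)

lemma mdeg_pos: "m \<noteq> 0 \<Longrightarrow> mdeg m > 0"
  unfolding mdeg_def
  by (rule gr0I) (auto simp: in_keys_iff intro: poly_mapping_eqI)

lemma coeff_mult: "coeff (f * g) m = (\<Sum>(a, b)\<in>splits m. coeff f a * coeff g b)"
  by transfer simp

lemma coeff_multE:
  assumes "coeff (f * g) m \<noteq> 0"
  obtains a b where "m = a + b" "coeff f a \<noteq> 0" "coeff g b \<noteq> 0"
proof -
  have "\<exists>p\<in>splits m. (case p of (a, b) \<Rightarrow> coeff f a * coeff g b) \<noteq> 0"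
    using assms sum.not_neutral_contains_not_neutral unfolding coeff_mult by blast
  then show thesis using that unfolding splits_def by force
qed

lemma coeff_one: "coeff 1 m = (if m = 0 then 1 else 0)"
  by transfer simp

lemma coeff_zero [simp]: "coeff 0 m = 0"
  by transfer simp

lemma coeff_add [simp]: "coeff (f + g) m = coeff f m + coeff g m"
  by transfer simp

lemma coeff_sum: "coeff (sum f A) m = (\<Sum>i\<in>A. coeff (f i) m)"
  by (induction A rule: infinite_finite_induct) auto

lemma coeff_sumE:
  assumes "coeff (sum f A) m \<noteq> 0"
  obtains i where "i \<in> A" "coeff (f i) m \<noteq> 0"
  using assms sum.not_neutral_contains_not_neutral unfolding coeff_sum by blast

lemma coeff_power_mdeg:
  assumes "coeff f 0 = 0" "coeff (f ^ n) m \<noteq> 0"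
  shows "n \<le> mdeg m"
  using assms(2)
proof (induction n arbitrary: m)
  case (Suc n)
  from Suc.prems obtain a b where ab: "m = a + b" "coeff f a \<noteq> 0" "coeff (f ^ n) b \<noteq> 0"
    by (auto elim: coeff_multE)
  have "mdeg a > 0" using ab(2) assms(1) by (intro mdeg_pos) auto
  with Suc.IH[OF ab(3)] show ?case by (simp add: ab(1) mdeg_add)
qed simp

lemma mps_exp_summable:
  assumes "coeff f 0 = 0"
  shows "mps_summable (\<lambda>n. mps_const (1 / fact n) * f ^ n) UNIV"
  unfolding mps_summable_def
proof
  fix m
  have "n \<le> mdeg m" if "coeff (mps_const (1 / fact n) * f ^ n) m \<noteq> 0" for n
  proof -
    from that obtain a b where ab: "m = a + b" "coeff (f ^ n) b \<noteq> 0"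
      by (auto elim: coeff_multE)
    with coeff_power_mdeg[OF assms ab(2)] show ?thesis by (simp add: mdeg_add)
  qed
  then have "{n \<in> UNIV. coeff (mps_const (1 / fact n) * f ^ n) m \<noteq> 0} \<subseteq> {..mdeg m}"
    by auto
  then show "finite {n \<in> UNIV. coeff (mps_const (1 / fact n) * f ^ n) m \<noteq> 0}"
    by (rule finite_subset) simp
qed

definition homogeneous :: "('v, 'a::zero) mps \<Rightarrow> nat \<Rightarrow> bool" where
  "homogeneous f d \<longleftrightarrow> (\<forall>m. coeff f m \<noteq> 0 \<longrightarrow> mdeg m = d)"

lemma homogeneous_mult:
  "homogeneous f d \<Longrightarrow> homogeneous g d' \<Longrightarrow> homogeneous (f * g) (d + d')"
  unfolding homogeneous_def by (auto elim!: coeff_multE simp: mdeg_add)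

lemma homogeneous_one: "homogeneous 1 0"
  by (auto simp: homogeneous_def coeff_one)

lemma homogeneous_power:
  assumes "homogeneous f d" shows "homogeneous (f ^ n) (n * d)"
proof (induction n)
  case (Suc n)
  then show ?case using homogeneous_mult[OF assms Suc] by simp
qed (simp add: homogeneous_one)

lemma homogeneous_sum:
  "(\<And>i. i \<in> A \<Longrightarrow> homogeneous (f i) d) \<Longrightarrow> homogeneous (sum f A) d"
  unfolding homogeneous_def by (blast elim: coeff_sumE)

lemma homogeneous_prod:
  "finite A \<Longrightarrow> (\<And>i. i \<in> A \<Longrightarrow> homogeneous (f i) (d i)) \<Longrightarrow> homogeneous (prod f A) (sum d A)"
proof (induction A rule: finite_induct)
  case (insert x A)
  then show ?case using homogeneous_mult[of "f x" "d x" "prod f A" "sum d A"] by simp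
qed (simp add: homogeneous_one)

lemma homogeneous_const: "homogeneous (mps_const c) 0"
  unfolding homogeneous_def by transfer auto

lemma homogeneous_var: "homogeneous (mps_var v) 1"
  unfolding homogeneous_def by transfer (auto simp: mdeg_def split: if_splits)

lemma sum_mset_eq_count: "(\<Sum>l\<in>set_mset M. l * count M l) = \<Sum>\<^sub># M" for M :: "nat multiset"
proof -
  have "(\<Sum>l\<in>S. l * count M l) = \<Sum>\<^sub># M" if "finite S" "set_mset M \<subseteq> S" for S
    using that(2)
  proof (induction M)
    case (add x M)
    have "(\<Sum>l\<in>S. l * count (add_mset x M) l)
        = (\<Sum>l\<in>S. l * count M l + (if l = x then x else 0))"
      by (rule sum.cong) auto
    also have "\<dots> = (\<Sum>l\<in>S. l * count M l) + x"
      using add.prems that(1) by (simp add: sum.distrib sum.delta)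
    finally show ?case using add by simp
  qed simp
  then show ?thesis by simp
qed

lemma homogeneous_weight:
  fixes f :: "nat \<Rightarrow> Z2 \<Rightarrow> rt_series"
  assumes "la \<in> bipartitions n" "\<And>l e. homogeneous (f l e) 1"
  shows "homogeneous (\<Prod>(l, e). f l e ^ (l * count (la e) l)) n"
proof -
  let ?S = "SIGMA e:UNIV. set_mset (la e)"
  let ?S' = "(\<lambda>(e, l). (l, e)) ` ?S"
  have supp: "{p. (case p of (l, e) \<Rightarrow> f l e ^ (l * count (la e) l)) \<noteq> 1} \<subseteq> ?S'"
  proof safe
    fix l e assume *: "f l e ^ (l * count (la e) l) \<noteq> 1"
    have "count (la e) l \<noteq> 0"
    proof
      assume "count (la e) l = 0"
      with * show False by simp
    qed
    then show "(l, e) \<in> ?S'" by (force simp: count_eq_zero_iff)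
  qed
  have "(\<Prod>(l, e). f l e ^ (l * count (la e) l))
      = (\<Prod>(l, e)\<in>?S'. f l e ^ (l * count (la e) l))"
    by (rule Prod_any.expand_superset[OF _ supp]) auto
  moreover have "homogeneous \<dots> (\<Sum>(l, e)\<in>?S'. l * count (la e) l)"
    by (rule homogeneous_prod) (use homogeneous_power[OF assms(2)] in auto)
  moreover have "(\<Sum>(l, e)\<in>?S'. l * count (la e) l) = (\<Sum>(e, l)\<in>?S. l * count (la e) l)"
    by (subst sum.reindex) (auto simp: inj_on_def case_prod_unfold)
  moreover have "\<dots> = (\<Sum>e\<in>UNIV. \<Sum>l\<in>set_mset (la e). l * count (la e) l)"
    by (rule sum.Sigma[symmetric]) auto
  moreover have "\<dots> = n"
    using assms(1) by (simp add: bipartitions_def sum_mset_eq_count)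
  ultimately show ?thesis by simp
qed

lemma cycle_index_summable:
  "mps_summable (\<lambda>n.
      mps_const (1 / of_nat (card (hyperoct n))) *
      (\<Sum>mu\<in>bipartitions n. \<Sum>y\<in>conj_class n mu.
        \<Sum>la\<in>bipartitions n. \<Sum>x | x \<in> conj_class n la \<and> x ^^ k = y.
          (\<Prod>(l, e). r_var l e ^ (l * count (la e) l)) *
          (\<Prod>(j, th). t_var j th ^ (j * count (mu th) j)))) UNIV"
  (is "mps_summable ?f UNIV")
proof -
  have "homogeneous (?f n) (0 + (n + n))" for n
    by (intro homogeneous_mult homogeneous_sum homogeneous_const homogeneous_weight)
      (auto simp: r_var_def t_var_def homogeneous_var[simplified])
  then have hom: "homogeneous (?f n) (n + n)" for n by (simp only: add_0)
  show ?thesis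
    unfolding mps_summable_def
  proof
    fix m
    have "{n \<in> UNIV. coeff (?f n) m \<noteq> 0} \<subseteq> {..mdeg m}"
    proof
      fix n assume "n \<in> {n \<in> UNIV. coeff (?f n) m \<noteq> 0}"
      then have "mdeg m = n + n" using hom[of n] unfolding homogeneous_def by blast
      then show "n \<in> {..mdeg m}" by simp
    qed
    then show "finite {n \<in> UNIV. coeff (?f n) m \<noteq> 0}" by (rule finite_subset) simp
  qed
qed

lemma coeff_var_power:
  assumes "coeff (mps_var v ^ n :: ('v, 'a::comm_ring_1) mps) m \<noteq> 0"
  shows "Poly_Mapping.lookup m v = n"
  using assms
proof (induction n arbitrary: m)
  case 0
  then show ?case by (auto simp: coeff_one split: if_splits)
next
  case (Suc n)
  from Suc.prems obtain a b where ab: "m = a + b" "coeff (mps_var v :: ('v, 'a) mps) a \<noteq> 0"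
      "coeff (mps_var v ^ n :: ('v, 'a) mps) b \<noteq> 0"
    by (auto elim: coeff_multE)
  have "a = Poly_Mapping.single v 1"
    using ab(2) by (simp add: mps_var.rep_eq split: if_splits)
  with Suc.IH[OF ab(3)] show ?case by (simp add: ab(1) lookup_add)
qed

lemma exponent_coeff:
  assumes "k > 0" "j > 0"
    and "coeff (\<Sum>h | h dvd k \<and> gcd h j = 1.
        mps_const (1 / of_nat (2 * (j * k div h))) * t_var j th ^ (j * k div h) *
        (\<Sum>e\<in>root_signs h th. r_var (j * k div h) e ^ (j * k div h))) m \<noteq> 0"
  shows "T j th \<in> Poly_Mapping.keys m"
proof -
  from assms(3) obtain h where h: "h dvd k" "coeff
        (mps_const (1 / of_nat (2 * (j * k div h))) * t_var j th ^ (j * k div h) *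
        (\<Sum>e\<in>root_signs h th. r_var (j * k div h) e ^ (j * k div h))) m \<noteq> 0"
    by (auto elim: coeff_sumE)
  from h(2) obtain a b where ab: "m = a + b"
      "coeff (mps_const (1 / of_nat (2 * (j * k div h))) * t_var j th ^ (j * k div h)) a \<noteq> 0"
    by (rule coeff_multE)
  from ab(2) obtain c d where cd: "a = c + d" "coeff (t_var j th ^ (j * k div h)) d \<noteq> 0"
    by (auto elim: coeff_multE)
  have "Poly_Mapping.lookup d (T j th) = j * k div h"
    by (rule coeff_var_power[OF cd(2)[unfolded t_var_def]])
  moreover have "j * k div h > 0"
    using h(1) assms(1,2) by (auto elim!: dvdE)
  ultimately show ?thesis by (simp add: ab(1) cd(1) in_keys_iff lookup_add)
qed

lemma exponent_summable:
  assumes "k > 0"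
  shows "mps_summable (\<lambda>(j, th).
      \<Sum>h | h dvd k \<and> gcd h j = 1.
        mps_const (1 / of_nat (2 * (j * k div h))) * t_var j th ^ (j * k div h) *
        (\<Sum>e\<in>root_signs h th. r_var (j * k div h) e ^ (j * k div h)))
      ({1..} \<times> UNIV)" (is "mps_summable ?f ?A")
  unfolding mps_summable_def
proof
  fix m :: "indet \<Rightarrow>\<^sub>0 nat"
  have inj: "inj_on (\<lambda>(j, th). T j th) {p \<in> ?A. coeff (?f p) m \<noteq> 0}"
    by (auto simp: inj_on_def)
  have "(\<lambda>(j, th). T j th) ` {p \<in> ?A. coeff (?f p) m \<noteq> 0} \<subseteq> Poly_Mapping.keys m"
  proof (intro image_subsetI)
    fix p assume p: "p \<in> {p \<in> ?A. coeff (?f p) m \<noteq> 0}"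
    obtain j th where "p = (j, th)" by (cases p)
    with p exponent_coeff[OF assms, of j th m]
    show "(case p of (j, th) \<Rightarrow> T j th) \<in> Poly_Mapping.keys m" by simp
  qed
  then have "finite ((\<lambda>(j, th). T j th) ` {p \<in> ?A. coeff (?f p) m \<noteq> 0})"
    by (rule finite_subset) simp
  then show "finite {p \<in> ?A. coeff (?f p) m \<noteq> 0}"
    using inj by (rule finite_imageD)
qed

lemma exponent_constant_term:
  assumes "k > 0"
  shows "coeff (mps_sum (\<lambda>(j, th).
      \<Sum>h | h dvd k \<and> gcd h j = 1.
        mps_const (1 / of_nat (2 * (j * k div h))) * t_var j th ^ (j * k div h) *
        (\<Sum>e\<in>root_signs h th. r_var (j * k div h) e ^ (j * k div h)))
      ({1..} \<times> UNIV)) 0 = 0"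
  unfolding mps_sum.rep_eq
  proof (rule sum.neutral, safe, goal_cases)
  case (1 j th)
  then show ?case using exponent_coeff[OF assms, of j th 0] by simp
qed

end

theory Submission
  imports Defs
begin

text \<open>
  Both \<open>x\<close> and \<open>x^k\<close> are recorded point by point: the exponents \<open>l * num_cycles\<close> count the
  positive points lying on cycles of given length and class, and a point on a cycle of \<open>x\<close> of length
  \<open>l\<close> and class \<open>e\<close> lies on a cycle of \<open>x^k\<close> of length \<open>l / gcd l k\<close> and class
  \<open>e^(k / gcd l k)\<close>. The left-hand side is thus a cycle index of the groups \<open>hyperoct n\<close> with
  weights \<open>g l e\<close> per point. Deleting a point from the cycle of a fixed \<open>p\<close> gives the recursion
  \<open>2 n Z\<^sub>n = (\<Sum>l=1..n. (g l 1 ^ l + g l (-1) ^ l) * Z\<^sub>n\<^sub>-\<^sub>l)\<close> for the normalised sums \<open>Z\<^sub>n\<close>, which says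
  that their generating function solves the differential equation (for the Euler operator) of
  \<open>exp (\<Sum>l e. g l e ^ l / (2 l))\<close>. The exponent is reindexed by \<open>l = j k / h\<close>,
  \<open>h = k / gcd l k\<close>, \<open>j = l / gcd l k\<close>.
\<close>

section \<open>The Euler operator on power series\<close>

lemma coeff_const_mult:
  fixes f :: "('v, 'a::comm_ring_1) mps"
  shows "coeff (mps_const c * f) m = c * coeff f m"
proof -
  have "coeff (mps_const c * f) m
      = (\<Sum>(a, b)\<in>{(0, m)}. coeff (mps_const c :: ('v, 'a) mps) a * coeff f b)"
    unfolding coeff_mult
  proof (rule sum.mono_neutral_right)
    show "finite (splits m)" by (rule finite_splits)
    show "{(0, m)} \<subseteq> splits m" by (simp add: splits_def)
    show "\<forall>i\<in>splits m - {(0, m)}. (case i of (a, b) \<Rightarrow> coeff (mps_const c) a * coeff f b) = 0"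
      by (auto simp: splits_def mps_const.rep_eq split: if_splits)
  qed
  then show ?thesis by (simp add: mps_const.rep_eq)
qed

lemma mps_const_of_nat: "mps_const (of_nat n) = (of_nat n :: ('v, 'a::comm_ring_1) mps)"
proof (induction n)
  case 0
  show ?case by (rule mps_eqI) (simp add: mps_const.rep_eq)
next
  case (Suc n)
  have "(mps_const (of_nat (Suc n)) :: ('v, 'a) mps) = 1 + mps_const (of_nat n)"
    by (rule mps_eqI) (simp add: mps_const.rep_eq coeff_one)
  with Suc show ?case by simp
qed

lemma mps_const_mult: "mps_const (a * b) = mps_const a * mps_const b"
  by (rule mps_eqI) (simp add: coeff_const_mult, simp add: mps_const.rep_eq)

lemma mps_const_1: "mps_const 1 = 1"
  by (rule mps_eqI) (simp add: mps_const.rep_eq coeff_one)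

lemma coeff_of_nat_mult: "coeff (of_nat n * f) m = of_nat n * coeff f m"
  by (simp add: mps_const_of_nat[symmetric] coeff_const_mult)

lemma coeff_mps_sum_superset:
  assumes "finite B" "B \<subseteq> A" "\<And>i. i \<in> A - B \<Longrightarrow> coeff (f i) m = 0"
  shows "coeff (mps_sum f A) m = (\<Sum>i\<in>B. coeff (f i) m)"
  unfolding mps_sum.rep_eq
  by (rule sum.mono_neutral_left) (use assms in auto)

text \<open>This is the sum of v * d/dv over all indeterminates v, a derivation that stays
  meaningful for infinitely many of them.\<close>

lift_definition mps_euler :: "('v, 'a::comm_ring_1) mps \<Rightarrow> ('v, 'a) mps"
  is "\<lambda>f m. of_nat (mdeg m) * f m" .

lemma mps_euler_mult: "mps_euler (f * g) = mps_euler f * g + f * mps_euler g"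
proof (rule mps_eqI)
  fix m
  have "coeff (mps_euler (f * g)) m
      = (\<Sum>(a, b)\<in>splits m. of_nat (mdeg m) * (coeff f a * coeff g b))"
    by (simp add: mps_euler.rep_eq coeff_mult sum_distrib_left case_prod_unfold)
  also have "\<dots> = (\<Sum>(a, b)\<in>splits m. (of_nat (mdeg a) * coeff f a) * coeff g b
      + coeff f a * (of_nat (mdeg b) * coeff g b))"
    by (rule sum.cong) (auto simp: splits_def mdeg_add algebra_simps)
  also have "\<dots> = coeff (mps_euler f * g + f * mps_euler g) m"
    by (simp add: mps_euler.rep_eq coeff_mult sum.distrib case_prod_unfold)
  finally show "coeff (mps_euler (f * g)) m = coeff (mps_euler f * g + f * mps_euler g) m" .
qed

lemma mps_euler_homogeneous: "homogeneous f d \<Longrightarrow> mps_euler f = of_nat d * f"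
proof (rule mps_eqI)
  fix m assume "homogeneous f d"
  then show "coeff (mps_euler f) m = coeff (of_nat d * f) m"
    by (cases "coeff f m = 0") (auto simp: mps_euler.rep_eq coeff_of_nat_mult homogeneous_def)
qed

lemma mps_euler_power: "mps_euler (f ^ Suc n) = of_nat (Suc n) * f ^ n * mps_euler f"
proof (induction n)
  case (Suc n)
  have "mps_euler (f ^ Suc (Suc n)) = mps_euler f * f ^ Suc n + f * mps_euler (f ^ Suc n)"
    by (simp only: power_Suc[of f "Suc n"] mps_euler_mult)
  then show ?case by (simp only: Suc) (simp add: algebra_simps)
qed simp

text \<open>Since h has no constant term, the equation expresses \<open>mdeg m\<close> times the
  coefficient at m by coefficients of lower degree. Characteristic zero allows the division by
  \<open>mdeg m\<close>, and induction on the degree concludes.\<close>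

lemma mps_euler_unique:
  fixes f g h :: "('v, 'a::field_char_0) mps"
  assumes f: "mps_euler f = h * f" and g: "mps_euler g = h * g"
    and h: "coeff h 0 = 0" and 0: "coeff f 0 = coeff g 0"
  shows "f = g"
proof (rule mps_eqI)
  fix m
  show "coeff f m = coeff g m"
  proof (induction "mdeg m" arbitrary: m rule: less_induct)
    case less
    show ?case
    proof (cases "m = 0")
      case False
      have "coeff (h * f) m = coeff (h * g) m"
        unfolding coeff_mult
      proof (rule sum.cong, simp, safe)
        fix a b assume ab: "(a, b) \<in> splits m"
        show "coeff h a * coeff f b = coeff h a * coeff g b"
        proof (cases "a = 0")
          case False
          then have "mdeg b < mdeg m"
            using ab mdeg_pos[of a] by (auto simp: splits_def mdeg_add)
          then show ?thesis using less by simp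
        qed (simp add: h)
      qed
      then have "of_nat (mdeg m) * coeff f m = of_nat (mdeg m) * coeff g m"
        using f g by (metis mps_euler.rep_eq)
      then show ?thesis using mdeg_pos[OF False] by simp
    qed (simp add: 0)
  qed
qed

text \<open>The bound N may exceed the degree, so that a single N serves for every factor of a
  monomial and the exponential can be handled as a finite sum.\<close>

lemma coeff_mps_exp:
  fixes f :: "('v, 'a::field_char_0) mps"
  assumes "coeff f 0 = 0" "mdeg m \<le> N"
  shows "coeff (mps_exp f) m = (\<Sum>n\<le>N. coeff (mps_const (1 / fact n) * f ^ n) m)"
  unfolding mps_exp_def
proof (rule coeff_mps_sum_superset)
  fix n assume "n \<in> UNIV - {..N}"
  then show "coeff (mps_const (1 / fact n) * f ^ n) m = 0"
    using coeff_power_mdeg[OF assms(1), of n m] assms(2) by (auto simp: coeff_const_mult)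
qed auto

text \<open>Term by term, the derivation turns f^n / n! into f^(n-1) / (n-1)! times
  \<open>mps_euler f\<close>; truncation at the degree of m keeps the rearrangement finite.\<close>

lemma mps_euler_exp:
  fixes f :: "('v, 'a::field_char_0) mps"
  assumes "coeff f 0 = 0"
  shows "mps_euler (mps_exp f) = mps_euler f * mps_exp f"
proof (rule mps_eqI)
  fix m :: "'v \<Rightarrow>\<^sub>0 nat"
  define N where "N = mdeg m"
  \<comment> \<open>The truncation runs one term past the degree: the operator kills n = 0, and the
    index shift then leaves n \<le> N.\<close>
  have "coeff (mps_euler (mps_exp f)) m
      = (\<Sum>n\<le>Suc N. coeff (mps_const (1 / fact n) * mps_euler (f ^ n)) m)"
    unfolding mps_euler.rep_eq
    by (subst coeff_mps_exp[OF assms, of _ "Suc N"])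
      (auto simp: N_def sum_distrib_left coeff_const_mult mps_euler.rep_eq mult.left_commute
        simp del: sum.atMost_Suc)
  also have "\<dots> = (\<Sum>n\<le>N. coeff (mps_const (1 / fact (Suc n)) * mps_euler (f ^ Suc n)) m)"
    by (subst sum.atMost_Suc_shift) (simp add: coeff_const_mult mps_euler.rep_eq coeff_one)
  also have "\<dots> = (\<Sum>n\<le>N. coeff (mps_euler f * (mps_const (1 / fact n) * f ^ n)) m)"
  proof (rule sum.cong, simp)
    fix n
    have "mps_const (1 / fact (Suc n)) * mps_euler (f ^ Suc n)
        = mps_const (1 / fact (Suc n)) * mps_const (of_nat (Suc n)) * f ^ n * mps_euler f"
      by (simp only: mps_euler_power mps_const_of_nat mult.assoc)
    also have "mps_const (1 / fact (Suc n)) * mps_const (of_nat (Suc n)) = mps_const (1 / fact n :: 'a)"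
      by (simp only: mps_const_mult[symmetric]) (simp add: divide_simps del: of_nat_Suc)
    finally show "coeff (mps_const (1 / fact (Suc n)) * mps_euler (f ^ Suc n)) m
        = coeff (mps_euler f * (mps_const (1 / fact n) * f ^ n)) m"
      by (simp add: mult_ac)
  qed
  also have "\<dots> = (\<Sum>(a, b)\<in>splits m. coeff (mps_euler f) a *
      (\<Sum>n\<le>N. coeff (mps_const (1 / fact n) * f ^ n) b))"
    unfolding coeff_mult[of "mps_euler f"]
    by (subst sum.swap) (simp add: sum_distrib_left case_prod_unfold)
  also have "\<dots> = coeff (mps_euler f * mps_exp f) m"
    unfolding coeff_mult[of "mps_euler f"]
  proof (rule sum.cong, simp, safe)
    fix a b assume "(a, b) \<in> splits m"
    then have "mdeg b \<le> N" by (auto simp: splits_def N_def mdeg_add)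
    then show "coeff (mps_euler f) a * (\<Sum>n\<le>N. coeff (mps_const (1 / fact n) * f ^ n) b)
        = coeff (mps_euler f) a * coeff (mps_exp f) b"
      by (simp only: coeff_mps_exp[OF assms])
  qed
  finally show "coeff (mps_euler (mps_exp f)) m = coeff (mps_euler f * mps_exp f) m" .
qed

section \<open>Graded families and the exponential formula\<close>

lemma coeff_mps_sum_graded:
  assumes "\<And>n. homogeneous (f n) (d * n)" "d > 0" "mdeg m \<le> N"
  shows "coeff (mps_sum f UNIV) m = (\<Sum>n\<le>N. coeff (f n) m)"
proof (rule coeff_mps_sum_superset)
  fix n assume n: "n \<in> UNIV - {..N}"
  show "coeff (f n) m = 0"
  proof (rule ccontr)
    assume "coeff (f n) m \<noteq> 0"
    then have "d * n = mdeg m" using assms(1)[of n] by (simp add: homogeneous_def)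
    moreover have "n \<le> d * n" using assms(2) by simp
    ultimately show False using n assms(3) by simp
  qed
qed auto

text \<open>The recursion is the differential equation read off degree by degree, its right-hand
  side being the degree d * n part of the Cauchy product.\<close>

lemma mps_euler_graded_sum:
  fixes Z G :: "nat \<Rightarrow> ('v, 'a::comm_ring_1) mps"
  assumes Z: "\<And>n. homogeneous (Z n) (d * n)" and G: "\<And>n. homogeneous (G n) (d * n)" and "d > 0"
    and rec: "\<And>n. of_nat (d * n) * Z n = (\<Sum>l\<le>n. G l * Z (n - l))"
  shows "mps_euler (mps_sum Z UNIV) = mps_sum G UNIV * mps_sum Z UNIV"
proof (rule mps_eqI)
  fix m :: "'v \<Rightarrow>\<^sub>0 nat"
  define N where "N = mdeg m"
  have "coeff (mps_euler (mps_sum Z UNIV)) m = (\<Sum>n\<le>N. coeff (of_nat (d * n) * Z n) m)"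
    by (simp add: mps_euler.rep_eq coeff_mps_sum_graded[OF Z \<open>d > 0\<close>, of m N] N_def
        sum_distrib_left mps_euler_homogeneous[OF Z, symmetric] del: of_nat_mult)
  also have "\<dots> = (\<Sum>n\<le>N. \<Sum>l\<le>n. coeff (G l * Z (n - l)) m)"
    by (simp only: rec coeff_sum)
  also have "\<dots> = (\<Sum>(l, n)\<in>{(l, n). l + n \<le> N}. coeff (G l * Z n) m)"
  proof -
    have "(\<Sum>n\<le>N. \<Sum>l\<le>n. coeff (G l * Z (n - l)) m)
        = (\<Sum>(n, l)\<in>(SIGMA n:{..N}. {..n}). coeff (G l * Z (n - l)) m)"
      by (rule sum.Sigma) auto
    also have "\<dots> = (\<Sum>(l, n)\<in>{(l, n). l + n \<le> N}. coeff (G l * Z n) m)"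
      by (rule sum.reindex_bij_witness[of _ "\<lambda>(l, n). (l + n, l)" "\<lambda>(n, l). (l, n - l)"]) auto
    finally show ?thesis .
  qed
  \<comment> \<open>Pairs outside the triangle have degree d * (l + n) > \<open>mdeg m\<close> and
    contribute nothing; on the square the double sum factors.\<close>
  also have "\<dots> = (\<Sum>(l, n)\<in>{..N} \<times> {..N}. coeff (G l * Z n) m)"
  proof (rule sum.mono_neutral_left)
    show "\<forall>i\<in>{..N} \<times> {..N} - {(l, n). l + n \<le> N}. (case i of (l, n) \<Rightarrow> coeff (G l * Z n) m) = 0"
    proof
      fix p assume "p \<in> {..N} \<times> {..N} - {(l, n). l + n \<le> N}"
      then obtain l n where p: "p = (l, n)" and ln: "\<not> l + n \<le> N" by auto
      have "homogeneous (G l * Z n) (d * l + d * n)"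
        by (rule homogeneous_mult[OF G Z])
      moreover have "mdeg m \<noteq> d * l + d * n"
      proof -
        have "l + n \<le> d * (l + n)" using \<open>d > 0\<close> by simp
        then show ?thesis using ln unfolding N_def by (simp add: algebra_simps)
      qed
      ultimately show "(case p of (l, n) \<Rightarrow> coeff (G l * Z n) m) = 0" by (auto simp: homogeneous_def p)
    qed
  qed auto
  also have "\<dots> = (\<Sum>(a, b)\<in>splits m. (\<Sum>l\<le>N. coeff (G l) a) * (\<Sum>n\<le>N. coeff (Z n) b))"
  proof -
    have "(\<Sum>(l, n)\<in>{..N} \<times> {..N}. coeff (G l * Z n) m)
        = (\<Sum>p\<in>{..N} \<times> {..N}. \<Sum>q\<in>splits m. coeff (G (fst p)) (fst q) * coeff (Z (snd p)) (snd q))"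
      by (simp add: coeff_mult case_prod_unfold)
    also have "\<dots> = (\<Sum>q\<in>splits m. \<Sum>p\<in>{..N} \<times> {..N}. coeff (G (fst p)) (fst q) * coeff (Z (snd p)) (snd q))"
      by (rule sum.swap)
    finally show ?thesis
      by (simp add: sum_product sum.cartesian_product case_prod_unfold)
  qed
  also have "\<dots> = coeff (mps_sum G UNIV * mps_sum Z UNIV) m"
    unfolding coeff_mult
  proof (rule sum.cong, simp, safe)
    fix a b assume "(a, b) \<in> splits m"
    then have "mdeg a \<le> N" "mdeg b \<le> N" by (auto simp: splits_def N_def mdeg_add)
    then show "(\<Sum>l\<le>N. coeff (G l) a) * (\<Sum>n\<le>N. coeff (Z n) b)
        = coeff (mps_sum G UNIV) a * coeff (mps_sum Z UNIV) b"
      by (simp only: coeff_mps_sum_graded[OF Z \<open>d > 0\<close>] coeff_mps_sum_graded[OF G \<open>d > 0\<close>])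
  qed
  finally show "coeff (mps_euler (mps_sum Z UNIV)) m = coeff (mps_sum G UNIV * mps_sum Z UNIV) m" .
qed

text \<open>Both sides satisfy the Euler equation with multiplier \<open>mps_sum G UNIV\<close> and
  have constant term 1: dividing the degree d * l part by d * l inverts the Euler operator. At l = 0
  the quotient 1 / 0 = 0 is harmless because G 0 = 0.\<close>

lemma mps_sum_eq_exp:
  fixes Z G :: "nat \<Rightarrow> ('v, 'a::field_char_0) mps"
  assumes Z: "\<And>n. homogeneous (Z n) (d * n)" and G: "\<And>n. homogeneous (G n) (d * n)" and "d > 0"
    and Z0: "Z 0 = 1" and G0: "G 0 = 0"
    and rec: "\<And>n. of_nat (d * n) * Z n = (\<Sum>l\<le>n. G l * Z (n - l))"
  shows "mps_sum Z UNIV = mps_exp (mps_sum (\<lambda>l. mps_const (1 / of_nat (d * l)) * G l) UNIV)"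
    (is "_ = mps_exp (mps_sum ?F UNIV)")
proof (rule mps_euler_unique)
  show "mps_euler (mps_sum Z UNIV) = mps_sum G UNIV * mps_sum Z UNIV"
    by (rule mps_euler_graded_sum[OF Z G \<open>d > 0\<close> rec])
  have F: "homogeneous (?F l) (d * l)" for l
    using homogeneous_mult[OF homogeneous_const G, of _ l] by simp
  have F0: "coeff (mps_sum ?F UNIV) 0 = 0"
    by (simp add: coeff_mps_sum_graded[OF F \<open>d > 0\<close>, of 0 0] G0 del: of_nat_mult)
  have "mps_euler (mps_sum ?F UNIV) = mps_sum G UNIV"
  proof (rule mps_eqI)
    fix m
    have *: "of_nat (mdeg m) * coeff (?F l) m = coeff (G l) m" for l
    proof (cases "coeff (G l) m = 0")
      case False
      then have "mdeg m = d * l" using G[of l] by (simp add: homogeneous_def)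
      moreover have "l \<noteq> 0" using False G0 by (metis coeff_zero)
      ultimately show ?thesis using \<open>d > 0\<close> by (simp add: coeff_const_mult)
    qed (simp add: coeff_const_mult)
    show "coeff (mps_euler (mps_sum ?F UNIV)) m = coeff (mps_sum G UNIV) m"
      by (simp only: mps_euler.rep_eq coeff_mps_sum_graded[OF F \<open>d > 0\<close> order_refl]
          coeff_mps_sum_graded[OF G \<open>d > 0\<close> order_refl] sum_distrib_left *)
  qed
  then show "mps_euler (mps_exp (mps_sum ?F UNIV)) = mps_sum G UNIV * mps_exp (mps_sum ?F UNIV)"
    by (simp only: mps_euler_exp[OF F0])
  show "coeff (mps_sum G UNIV) 0 = 0"
    by (simp add: coeff_mps_sum_graded[OF G \<open>d > 0\<close>, of 0 0] G0)
  show "coeff (mps_sum Z UNIV) 0 = coeff (mps_exp (mps_sum ?F UNIV)) 0"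
    by (simp add: coeff_mps_sum_graded[OF Z \<open>d > 0\<close>, of 0 0] coeff_mps_exp[OF F0, of 0 0]
        Z0 mps_const_1 coeff_const_mult del: of_nat_mult)
qed

section \<open>Signed permutations and their cycles\<close>

text \<open>
  Signed permutations of an arbitrary symmetric set \<open>A\<close>, needed because removing a point leaves the
  sets \<open>pm_set n\<close>.
\<close>

definition signed_perms :: "int set \<Rightarrow> (int \<Rightarrow> int) set" where
  "signed_perms A = {w. w permutes A \<and> (\<forall>x. w (- x) = - w x)}"

definition symmetric_set :: "int set \<Rightarrow> bool" where
  "symmetric_set A \<longleftrightarrow> finite A \<and> 0 \<notin> A \<and> uminus ` A = A"

section \<open>Length and class of the signed cycle through a point\<close>

definition act :: "Z2 \<Rightarrow> int \<Rightarrow> int" where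
  "act e x = (if e = 1 then x else - x)"

text \<open>The first return up to sign measures both classes uniformly: the full length of a cycle
  distinct from its negative, and half the length of a self-negative one.\<close>

definition slen :: "(int \<Rightarrow> int) \<Rightarrow> int \<Rightarrow> nat" where
  "slen w x = (LEAST l. l > 0 \<and> ((w ^^ l) x = x \<or> (w ^^ l) x = - x))"

definition scls :: "(int \<Rightarrow> int) \<Rightarrow> int \<Rightarrow> Z2" where
  "scls w x = (if (w ^^ slen w x) x = x then 1 else - 1)"

text \<open>Including both signs gives the union of a cycle and its negative, whatever the class, so
  that no case distinction is needed.\<close>

definition scycle :: "(int \<Rightarrow> int) \<Rightarrow> int \<Rightarrow> int set" where
  "scycle w x = {act e ((w ^^ j) x) | e j. j < slen w x}"

lemma Z2_cases: "e = 1 \<or> e = (- 1 :: Z2)"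
  using UNIV_Z2 by auto

lemma Z2_one_neq [simp]: "(1 :: Z2) \<noteq> - 1" "(- 1 :: Z2) \<noteq> 1"
  by (transfer; simp)+

lemma Z2_minus_mult [simp]: "(- 1 :: Z2) * e = - e" "- (- e) = (e :: Z2)"
  by (transfer; simp)+

lemma act_1 [simp]: "act 1 x = x" and act_m1 [simp]: "act (- 1) x = - x"
  by (simp_all add: act_def)

lemma act_mult: "act (d * e) x = act d (act e x)"
  using Z2_cases[of d] Z2_cases[of e] by auto

lemma abs_eq_iff_act: "\<bar>x\<bar> = \<bar>y\<bar> \<longleftrightarrow> (\<exists>e. x = act e y)"
  by (auto simp: act_def abs_eq_iff intro: exI[of _ 1] exI[of _ "- 1"])

lemma abs_act [simp]: "\<bar>act e x\<bar> = \<bar>x\<bar>"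
  by (simp add: act_def)

lemma symmetric_set_uminus: "symmetric_set A \<Longrightarrow> - x \<in> A \<longleftrightarrow> x \<in> A"
  unfolding symmetric_set_def by (metis imageI minus_minus)

lemma symmetric_set_Diff: "symmetric_set A \<Longrightarrow> symmetric_set (A - {q, - q})"
proof -
  assume A: "symmetric_set A"
  have "x \<in> uminus ` (A - {q, - q})" if "x \<in> A" "x \<noteq> q" "x \<noteq> - q" for x
    using that symmetric_set_uminus[OF A, of x] by (intro image_eqI[of _ _ "- x"]) auto
  with A show ?thesis by (auto simp: symmetric_set_def)
qed

lemma card_symmetric_set:
  assumes "symmetric_set A" shows "card A = 2 * card {x \<in> A. x > 0}"
proof -
  have A: "A = {x \<in> A. x > 0} \<union> uminus ` {x \<in> A. x > 0}"
    using assms symmetric_set_uminus[OF assms]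
    by (auto simp: symmetric_set_def image_iff) (metis minus_minus neg_0_less_iff_less linorder_cases)
  have "card ({x \<in> A. x > 0} \<union> uminus ` {x \<in> A. x > 0})
      = card {x \<in> A. x > 0} + card (uminus ` {x \<in> A. x > 0})"
    using assms by (intro card_Un_disjoint) (auto simp: symmetric_set_def)
  with A show ?thesis by (simp add: card_image)
qed

lemma signed_perms_funpow_uminus: "w \<in> signed_perms A \<Longrightarrow> (w ^^ m) (- x) = - (w ^^ m) x"
  by (induction m) (auto simp: signed_perms_def)

lemma signed_perms_funpow_act: "w \<in> signed_perms A \<Longrightarrow> (w ^^ m) (act e x) = act e ((w ^^ m) x)"
  using signed_perms_funpow_uminus by (simp add: act_def)

lemma funpow_permutes: "w permutes A \<Longrightarrow> (w ^^ m) permutes A"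
  by (induction m) (auto simp: permutes_id id_def[symmetric] intro: permutes_compose)

lemma signed_perms_funpow: "w \<in> signed_perms A \<Longrightarrow> (w ^^ m) \<in> signed_perms A"
  using signed_perms_funpow_uminus funpow_permutes by (auto simp: signed_perms_def)

lemma signed_perms_nonzero: "w \<in> signed_perms A \<Longrightarrow> x \<noteq> 0 \<Longrightarrow> w x \<noteq> 0"
  unfolding signed_perms_def
  by (metis (mono_tags, lifting) mem_Collect_eq neg_equal_zero permutes_inverses(2) add.inverse_neutral)

lemma signed_perms_slen_ex:
  assumes "w \<in> signed_perms A" "finite A"
  shows "\<exists>l>0. (w ^^ l) x = x"
proof -
  have "permutation w" using assms by (auto simp: signed_perms_def permutation_permutes)
  then have "x \<in> orbit w x" by (rule permutation_self_in_orbit)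
  then show ?thesis by (auto simp: orbit_altdef dest: sym)
qed

text \<open>A certificate that names the candidate values of \<open>slen\<close> and
  \<open>scls\<close>; for a modified permutation these are obtained by verifying it instead of
  working with \<open>LEAST\<close>.\<close>

definition is_scycle :: "(int \<Rightarrow> int) \<Rightarrow> int \<Rightarrow> nat \<Rightarrow> Z2 \<Rightarrow> bool" where
  "is_scycle w x l e \<longleftrightarrow> l > 0 \<and> (w ^^ l) x = act e x \<and> (\<forall>j. 0 < j \<and> j < l \<longrightarrow> \<bar>(w ^^ j) x\<bar> \<noteq> \<bar>x\<bar>)"

lemma is_scycleD:
  assumes "is_scycle w x l e" "x \<noteq> 0" shows "slen w x = l" "scls w x = e"
proof -
  have l: "l > 0" "(w ^^ l) x = act e x" using assms by (auto simp: is_scycle_def)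
  show *: "slen w x = l"
    unfolding slen_def
  proof (rule Least_equality)
    show "l > 0 \<and> ((w ^^ l) x = x \<or> (w ^^ l) x = - x)" using l by (simp add: act_def)
    fix j assume "j > 0 \<and> ((w ^^ j) x = x \<or> (w ^^ j) x = - x)"
    then show "l \<le> j" using assms(1) unfolding is_scycle_def by (metis abs_minus_cancel not_le)
  qed
  show "scls w x = e"
    unfolding scls_def * using l(2) assms(2) Z2_cases[of e] by (auto simp: act_def)
qed

lemma is_scycleI:
  assumes "w \<in> signed_perms A" "finite A"
  shows "is_scycle w x (slen w x) (scls w x)"
proof -
  let ?P = "\<lambda>l. l > 0 \<and> ((w ^^ l) x = x \<or> (w ^^ l) x = - x)"
  have "\<exists>l. ?P l" using signed_perms_slen_ex[OF assms] by blast
  then have "?P (slen w x)" unfolding slen_def by (rule LeastI_ex)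
  moreover have "\<not> ?P j" if "j < slen w x" for j
    using that unfolding slen_def by (rule not_less_Least)
  ultimately show ?thesis unfolding is_scycle_def scls_def by (auto simp: abs_eq_iff)
qed

lemma funpow_slen:
  assumes "w \<in> signed_perms A" "finite A"
  shows "slen w x > 0" "(w ^^ slen w x) x = act (scls w x) x"
    "0 < j \<Longrightarrow> j < slen w x \<Longrightarrow> \<bar>(w ^^ j) x\<bar> \<noteq> \<bar>x\<bar>"
  using is_scycleI[OF assms, of x] unfolding is_scycle_def by auto

lemma funpow_slen_mult:
  assumes "w \<in> signed_perms A" "finite A"
  shows "(w ^^ (slen w x * a)) x = act (scls w x ^ a) x"
proof (induction a)
  case (Suc a)
  have "(w ^^ (slen w x * Suc a)) x = (w ^^ (slen w x)) ((w ^^ (slen w x * a)) x)"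
    by (simp add: funpow_add)
  also have "\<dots> = act (scls w x ^ Suc a) x"
    by (simp only: Suc signed_perms_funpow_act[OF assms(1)] funpow_slen[OF assms] act_mult[symmetric]
        power_Suc2)
  finally show ?case .
qed simp

lemma abs_funpow_eq:
  assumes "w \<in> signed_perms A" "finite A"
  shows "\<bar>(w ^^ m) x\<bar> = \<bar>(w ^^ (m mod slen w x)) x\<bar>"
proof -
  let ?l = "slen w x"
  have "(w ^^ (m mod ?l + ?l * (m div ?l))) x = (w ^^ (m mod ?l)) ((w ^^ (?l * (m div ?l))) x)"
    unfolding funpow_add by simp
  then show ?thesis
    by (simp add: funpow_slen_mult[OF assms] signed_perms_funpow_act[OF assms(1)])
qed

text \<open>Reducing m modulo \<open>slen w x\<close> does not change the absolute value, and no
  nonzero remainder returns to x up to sign.\<close>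

lemma abs_funpow_eq_self_iff:
  assumes "w \<in> signed_perms A" "finite A"
  shows "\<bar>(w ^^ m) x\<bar> = \<bar>x\<bar> \<longleftrightarrow> slen w x dvd m"
proof
  assume "\<bar>(w ^^ m) x\<bar> = \<bar>x\<bar>"
  then have "\<bar>(w ^^ (m mod slen w x)) x\<bar> = \<bar>x\<bar>" by (simp only: abs_funpow_eq[OF assms, of m x])
  then have "m mod slen w x = 0"
    using funpow_slen(3)[OF assms, of "m mod slen w x" x] funpow_slen(1)[OF assms, of x]
    by (metis mod_less_divisor neq0_conv)
  then show "slen w x dvd m" by presburger
next
  assume "slen w x dvd m"
  then show "\<bar>(w ^^ m) x\<bar> = \<bar>x\<bar>" using abs_funpow_eq[OF assms, of m x] by simp
qed

lemma scycle_iff: "y \<in> scycle w x \<longleftrightarrow> (\<exists>j < slen w x. \<bar>y\<bar> = \<bar>(w ^^ j) x\<bar>)"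
  by (auto simp: scycle_def abs_eq_iff_act)

lemma scycle_alt:
  assumes "w \<in> signed_perms A" "finite A"
  shows "y \<in> scycle w x \<longleftrightarrow> (\<exists>m. \<bar>y\<bar> = \<bar>(w ^^ m) x\<bar>)"
proof
  assume "y \<in> scycle w x" then show "\<exists>m. \<bar>y\<bar> = \<bar>(w ^^ m) x\<bar>" by (auto simp: scycle_def)
next
  assume "\<exists>m. \<bar>y\<bar> = \<bar>(w ^^ m) x\<bar>"
  then obtain m where "\<bar>y\<bar> = \<bar>(w ^^ m) x\<bar>" ..
  then have "\<bar>y\<bar> = \<bar>(w ^^ (m mod slen w x)) x\<bar>" by (simp only: abs_funpow_eq[OF assms, of m x])
  then show "y \<in> scycle w x"
    unfolding scycle_iff using funpow_slen(1)[OF assms, of x] by (auto intro!: mod_less_divisor)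
qed

lemma funpow_inj:
  assumes "w \<in> signed_perms A" "(w ^^ m) x = (w ^^ m) y" shows "x = y"
  using assms signed_perms_funpow[OF assms(1), of m] permutes_inj unfolding signed_perms_def
  by (metis (mono_tags, lifting) injD mem_Collect_eq)

lemma abs_funpow_cancel:
  assumes "w \<in> signed_perms A" "\<bar>(w ^^ m) x\<bar> = \<bar>(w ^^ m) y\<bar>" shows "\<bar>x\<bar> = \<bar>y\<bar>"
proof -
  from assms(2) obtain e where "(w ^^ m) x = act e ((w ^^ m) y)" by (auto simp: abs_eq_iff_act)
  then have "(w ^^ m) x = (w ^^ m) (act e y)" by (simp add: signed_perms_funpow_act[OF assms(1)])
  then show ?thesis using funpow_inj[OF assms(1)] by fastforce
qed

lemma inj_on_abs_funpow:
  assumes "w \<in> signed_perms A" "finite A"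
  shows "inj_on (\<lambda>j. \<bar>(w ^^ j) x\<bar>) {..<slen w x}"
proof (rule linorder_inj_onI)
  fix i j assume ij: "i < j" "j \<in> {..<slen w x}"
  show "\<bar>(w ^^ i) x\<bar> \<noteq> \<bar>(w ^^ j) x\<bar>"
  proof
    assume "\<bar>(w ^^ i) x\<bar> = \<bar>(w ^^ j) x\<bar>"
    moreover have "(w ^^ j) x = (w ^^ i) ((w ^^ (j - i)) x)"
      using ij funpow_add[of i "j - i" w] by simp
    ultimately have "\<bar>x\<bar> = \<bar>(w ^^ (j - i)) x\<bar>" using abs_funpow_cancel[OF assms(1)] by metis
    then show False using funpow_slen(3)[OF assms(1,2), of "j - i" x] ij
      by (simp add: less_imp_diff_less)
  qed
qed auto

text \<open>Of each pair of entries y, - y exactly one is positive, and the first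
  \<open>slen w x\<close> iterates have distinct absolute values.\<close>

lemma scycle_positive:
  assumes "w \<in> signed_perms A" "finite A" "x \<noteq> 0"
  shows "card {y \<in> scycle w x. y > 0} = slen w x"
proof -
  have nz: "(w ^^ j) x \<noteq> 0" for j
    using signed_perms_nonzero[OF signed_perms_funpow[OF assms(1)] assms(3)] by blast
  have "{y \<in> scycle w x. y > 0} = (\<lambda>j. \<bar>(w ^^ j) x\<bar>) ` {..<slen w x}"
  proof (rule set_eqI)
    fix y
    show "y \<in> {y \<in> scycle w x. y > 0} \<longleftrightarrow> y \<in> (\<lambda>j. \<bar>(w ^^ j) x\<bar>) ` {..<slen w x}"
      using nz by (cases "y > 0") (auto simp: scycle_iff image_iff)
  qed
  then show ?thesis using inj_on_abs_funpow[OF assms(1,2)] by (simp add: card_image)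
qed

text \<open>Powers of w commute with one another and with sign changes, so the certificate for x is
  carried to y by \<open>w ^^ j\<close> and a sign; injectivity up to sign rules out an earlier
  return.\<close>

lemma scycle_invariant:
  assumes "w \<in> signed_perms A" "finite A" "x \<noteq> 0" "y \<in> scycle w x"
  shows "slen w y = slen w x" "scls w y = scls w x"
proof -
  obtain e j where y: "y = act e ((w ^^ j) x)" using assms(4) by (auto simp: scycle_def)
  have fp: "(w ^^ m) y = act e ((w ^^ j) ((w ^^ m) x))" for m
    using fun_cong[OF funpow_add[of m j w], of x] fun_cong[OF funpow_add[of j m w], of x]
    by (simp add: y signed_perms_funpow_act[OF assms(1)] add.commute del: funpow.simps)
  have "is_scycle w y (slen w x) (scls w x)"
    unfolding is_scycle_def
  proof (intro conjI allI impI)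
    show "(w ^^ slen w x) y = act (scls w x) y"
      by (simp only: fp funpow_slen(2)[OF assms(1,2)] signed_perms_funpow_act[OF assms(1)])
        (simp add: y act_mult[symmetric] mult.commute)
    fix i assume "0 < i \<and> i < slen w x"
    then have "\<bar>(w ^^ i) x\<bar> \<noteq> \<bar>x\<bar>" using funpow_slen(3)[OF assms(1,2)] by blast
    then show "\<bar>(w ^^ i) y\<bar> \<noteq> \<bar>y\<bar>"
      using abs_funpow_cancel[OF assms(1), of j "(w ^^ i) x" x] fp[of i] y by auto
  qed (use funpow_slen[OF assms(1,2)] in auto)
  moreover have "y \<noteq> 0"
    using signed_perms_nonzero[OF signed_perms_funpow[OF assms(1)] assms(3)] by (simp add: y act_def)
  ultimately show "slen w y = slen w x" "scls w y = scls w x" using is_scycleD by blast+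
qed


text \<open>Meeting up to sign at arbitrary times suffices: following the orbit of x until it closes
  expresses x, up to sign, as an iterate of y.\<close>

lemma scycle_closed:
  assumes "w \<in> signed_perms A" "finite A" "\<bar>(w ^^ m) x\<bar> = \<bar>(w ^^ j) y\<bar>"
  shows "x \<in> scycle w y"
proof -
  \<comment> \<open>A multiple of the cycle length that is at least m, so that x has returned up to
    sign at time N.\<close>
  define N where "N = slen w x * m"
  have "m \<le> N" using funpow_slen(1)[OF assms(1,2), of x] by (simp add: N_def)
  from assms(3) obtain e where e: "(w ^^ m) x = act e ((w ^^ j) y)" by (auto simp: abs_eq_iff_act)
  have "(w ^^ N) x = (w ^^ (N - m)) ((w ^^ m) x)"
    using \<open>m \<le> N\<close> funpow_add[of "N - m" m w] by simp
  also have "\<dots> = act e ((w ^^ (N - m + j)) y)"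
    unfolding e signed_perms_funpow_act[OF assms(1)] funpow_add by simp
  finally have "\<bar>(w ^^ N) x\<bar> = \<bar>(w ^^ (N - m + j)) y\<bar>" by simp
  moreover have "\<bar>(w ^^ N) x\<bar> = \<bar>x\<bar>"
    unfolding N_def by (simp add: funpow_slen_mult[OF assms(1,2)])
  ultimately show ?thesis unfolding scycle_alt[OF assms(1,2)] by metis
qed

lemma scycle_subset:
  assumes "w \<in> signed_perms A" "symmetric_set A" "x \<in> A"
  shows "scycle w x \<subseteq> A"
proof
  fix y assume "y \<in> scycle w x"
  then obtain e j where y: "y = act e ((w ^^ j) x)" by (auto simp: scycle_def)
  have "(w ^^ j) x \<in> A"
    using signed_perms_funpow[OF assms(1), of j] assms(3) permutes_in_image
    by (fastforce simp: signed_perms_def)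
  then show "y \<in> A" using symmetric_set_uminus[OF assms(2)] by (simp add: y act_def)
qed

section \<open>Signed permutations sorted by the image of one point\<close>

lemma finite_signed_perms: "finite A \<Longrightarrow> finite (signed_perms A)"
  by (rule finite_subset[OF _ finite_permutations[of A]]) (auto simp: signed_perms_def)

lemma signed_perms_compose: "v \<in> signed_perms A \<Longrightarrow> w \<in> signed_perms A \<Longrightarrow> v \<circ> w \<in> signed_perms A"
  by (auto simp: signed_perms_def permutes_compose)

lemma signed_perms_mono: "v \<in> signed_perms B \<Longrightarrow> B \<subseteq> A \<Longrightarrow> v \<in> signed_perms A"
  by (auto simp: signed_perms_def permutes_subset)

text \<open>For q = p this is the identity and for q = - p the sign change at p, so the fibres over
  p and - p are covered by the same formula.\<close>

definition stransp :: "int \<Rightarrow> int \<Rightarrow> int \<Rightarrow> int" where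
  "stransp p q x = (if x = p then q else if x = q then p else if x = - p then - q
    else if x = - q then - p else x)"

lemma stransp_involution: "p \<noteq> 0 \<Longrightarrow> q \<noteq> 0 \<Longrightarrow> stransp p q (stransp p q x) = x"
  by (auto simp: stransp_def)

lemma stransp_other: "\<bar>x\<bar> \<noteq> \<bar>p\<bar> \<Longrightarrow> \<bar>x\<bar> \<noteq> \<bar>q\<bar> \<Longrightarrow> stransp p q x = x"
  by (auto simp: stransp_def)

lemma stransp_signed_perms:
  assumes "symmetric_set A" "p \<in> A" "q \<in> A"
  shows "stransp p q \<in> signed_perms A"
proof -
  have nz: "p \<noteq> 0" "q \<noteq> 0" using assms by (auto simp: symmetric_set_def)
  have "stransp p q x = x" if "x \<notin> A" for x
    using that assms symmetric_set_uminus[OF assms(1)] by (auto simp: stransp_def)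
  moreover have "\<exists>!x. stransp p q x = y" for y
    using stransp_involution[OF nz] by metis
  ultimately have "stransp p q permutes A" unfolding permutes_def by blast
  moreover have "stransp p q (- x) = - stransp p q x" for x
    using nz by (auto simp: stransp_def)
  ultimately show ?thesis by (simp add: signed_perms_def)
qed

text \<open>Precomposing with the transposition moves the value q from p to q itself, so q and - q
  become fixed and can be removed from the set. The transposition is an involution, hence the
  passage is reversible.\<close>

lemma signed_perms_fibre:
  assumes "symmetric_set A" "p \<in> A" "q \<in> A"
  shows "{w \<in> signed_perms A. w p = q} = (\<lambda>v. v \<circ> stransp p q) ` signed_perms (A - {q, - q})"
proof (intro equalityI subsetI)
  fix w assume w: "w \<in> {w \<in> signed_perms A. w p = q}"
  define v where "v = w \<circ> stransp p q"
  have nz: "p \<noteq> 0" "q \<noteq> 0" using assms by (auto simp: symmetric_set_def)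
  have v: "v \<in> signed_perms A"
    unfolding v_def using w stransp_signed_perms[OF assms] by (intro signed_perms_compose) auto
  have "v q = q" using w by (auto simp: v_def stransp_def)
  moreover have "v (- q) = - v q" using v by (simp add: signed_perms_def)
  ultimately have "\<forall>x\<in>A - (A - {q, - q}). v x = x" by (metis DiffE Diff_iff insertE singletonD)
  moreover have "v permutes A" using v by (simp add: signed_perms_def)
  ultimately have "v permutes (A - {q, - q})" using permutes_superset by blast
  then have "v \<in> signed_perms (A - {q, - q})" using v by (auto simp: signed_perms_def)
  moreover have "w = v \<circ> stransp p q"
    using stransp_involution[OF nz] by (auto simp: v_def)
  ultimately show "w \<in> (\<lambda>v. v \<circ> stransp p q) ` signed_perms (A - {q, - q})" by blast
next
  fix w assume "w \<in> (\<lambda>v. v \<circ> stransp p q) ` signed_perms (A - {q, - q})"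
  then obtain v where v: "v \<in> signed_perms (A - {q, - q})" and w: "w = v \<circ> stransp p q" by blast
  have "v q = q" using v by (auto simp: signed_perms_def permutes_not_in)
  then have "w p = q" by (simp add: w stransp_def)
  moreover have "w \<in> signed_perms A"
    unfolding w using signed_perms_mono[OF v] stransp_signed_perms[OF assms]
    by (intro signed_perms_compose) auto
  ultimately show "w \<in> {w \<in> signed_perms A. w p = q}" by simp
qed

lemma sum_signed_perms_split:
  assumes A: "symmetric_set A" and p: "p \<in> A"
  shows "(\<Sum>w\<in>signed_perms A. f w)
    = (\<Sum>q\<in>A. \<Sum>v\<in>signed_perms (A - {q, - q}). f (v \<circ> stransp p q))"
proof -
  have fin: "finite A" "0 \<notin> A" using A by (auto simp: symmetric_set_def)
  have "(\<Sum>w\<in>signed_perms A. f w) = (\<Sum>q\<in>A. \<Sum>w\<in>{w \<in> signed_perms A. w p = q}. f w)"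
    using p fin by (intro sum.group[symmetric] finite_signed_perms)
      (auto simp: signed_perms_def permutes_in_image)
  also have "\<dots> = (\<Sum>q\<in>A. \<Sum>v\<in>signed_perms (A - {q, - q}). f (v \<circ> stransp p q))"
  proof (rule sum.cong[OF refl])
    fix q assume q: "q \<in> A"
    have nz: "p \<noteq> 0" "q \<noteq> 0" using p q fin by auto
    have "inj_on (\<lambda>v. v \<circ> stransp p q) (signed_perms (A - {q, - q}))"
    proof (rule inj_onI, rule ext)
      fix u v :: "int \<Rightarrow> int" and x assume "u \<circ> stransp p q = v \<circ> stransp p q"
      then have "u (stransp p q (stransp p q x)) = v (stransp p q (stransp p q x))"
        by (metis o_apply)
      then show "u x = v x" by (simp add: stransp_involution[OF nz])
    qed
    then show "(\<Sum>w\<in>{w \<in> signed_perms A. w p = q}. f w)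
        = (\<Sum>v\<in>signed_perms (A - {q, - q}). f (v \<circ> stransp p q))"
      by (simp add: signed_perms_fibre[OF A p q] sum.reindex)
  qed
  finally show ?thesis .
qed

section \<open>Inserting a point into the cycle of p\<close>

context
  fixes A :: "int set" and p q :: int and v w :: "int \<Rightarrow> int"
  assumes A: "symmetric_set A" and p: "p \<in> A" and q: "q \<in> A"
    and v: "v \<in> signed_perms (A - {q, - q})"
  defines "w \<equiv> v \<circ> stransp p q"
begin

lemma extend_finite: "finite A" "finite (A - {q, - q})" and extend_nz: "p \<noteq> 0"
  using A p q by (auto simp: symmetric_set_def)

lemma extend_mem: "w \<in> signed_perms A" and extend_at: "w p = q"
  using signed_perms_fibre[OF A p q] v unfolding w_def by blast+

lemma extend_apply_other: "\<bar>x\<bar> \<noteq> \<bar>p\<bar> \<Longrightarrow> \<bar>x\<bar> \<noteq> \<bar>q\<bar> \<Longrightarrow> w x = v x"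
  by (simp add: w_def stransp_other)

text \<open>The signed cycle of p contains both p and q = w p, so an orbit off it never meets the
  points where v and w differ.\<close>

lemma extend_other:
  assumes "x \<notin> scycle w p"
  shows "slen w x = slen v x" "scls w x = scls v x"
proof -
  have ne: "\<bar>(w ^^ m) x\<bar> \<noteq> \<bar>p\<bar>" "\<bar>(w ^^ m) x\<bar> \<noteq> \<bar>q\<bar>" for m
    using scycle_closed[OF extend_mem extend_finite(1), of m x 0 p] scycle_closed[OF extend_mem extend_finite(1), of m x 1 p] assms extend_at
    by auto
  have "(w ^^ m) x = (v ^^ m) x" for m
  proof (induction m)
    case (Suc m)
    then show ?case using extend_apply_other[OF ne[of m]] by simp
  qed simp
  then show "slen w x = slen v x" "scls w x = scls v x" by (simp_all add: slen_def scls_def)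
qed

lemma extend_fixed:
  assumes "q = act e p"
  shows "slen w p = 1" "scls w p = e" "scycle w p = {q, - q}"
proof -
  have "is_scycle w p 1 e" using extend_at assms by (auto simp: is_scycle_def)
  then show *: "slen w p = 1" "scls w p = e" using is_scycleD extend_nz by blast+
  show "scycle w p = {q, - q}"
    by (rule set_eqI) (use assms in \<open>auto simp: scycle_iff * act_def split: if_splits\<close>)
qed

text \<open>Since w takes p to q and q to v p, the point q enters the cycle right after p. The later
  iterates are those of v delayed by one step, and the sign at the return is unchanged.\<close>

lemma extend_insert:
  assumes "\<bar>q\<bar> \<noteq> \<bar>p\<bar>"
  shows "slen w p = Suc (slen v p)" "scls w p = scls v p" "scycle w p = scycle v p \<union> {q, - q}"
proof -
  \<comment> \<open>The delay fails at m = 0, where w has reached q; the range includes the time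
    \<open>slen v p\<close> of the return.\<close>
  have fp: "(w ^^ Suc m) p = (v ^^ m) p" if "0 < m" "m \<le> slen v p" for m
    using that
  proof (induction m)
    case (Suc m)
    show ?case
    proof (cases "m = 0")
      case True
      have "w q = v p" using assms by (auto simp: w_def stransp_def)
      then show ?thesis using True extend_at by simp
    next
      case False
      have 1: "\<bar>(v ^^ m) p\<bar> \<noteq> \<bar>p\<bar>"
        using False Suc.prems by (intro funpow_slen(3)[OF v extend_finite(2)]) auto
      have "(v ^^ m) permutes (A - {q, - q})"
        using signed_perms_funpow[OF v] by (auto simp: signed_perms_def)
      moreover have "p \<in> A - {q, - q}" using p assms by auto
      ultimately have "(v ^^ m) p \<in> A - {q, - q}" by (simp only: permutes_in_image)
      then have "\<bar>(v ^^ m) p\<bar> \<noteq> \<bar>q\<bar>" by (auto simp: abs_eq_iff)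
      then have "w ((v ^^ m) p) = v ((v ^^ m) p)" using 1 by (intro extend_apply_other)
      then show ?thesis using Suc False by simp
    qed
  qed simp
  have ne: "\<bar>(w ^^ j) p\<bar> \<noteq> \<bar>p\<bar>" if "0 < j" "j < Suc (slen v p)" for j
  proof (cases "j = 1")
    case True
    then show ?thesis using extend_at assms by simp
  next
    case False
    then have "(w ^^ j) p = (v ^^ (j - 1)) p" using fp[of "j - 1"] that by simp
    then show ?thesis using False that funpow_slen(3)[OF v extend_finite(2), of "j - 1" p] by auto
  qed
  have "(w ^^ Suc (slen v p)) p = act (scls v p) p"
    using fp[of "slen v p"] funpow_slen(1,2)[OF v extend_finite(2), of p] by (simp del: funpow.simps)
  then have "is_scycle w p (Suc (slen v p)) (scls v p)"
    using ne by (simp add: is_scycle_def del: funpow.simps)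
  then show *: "slen w p = Suc (slen v p)" "scls w p = scls v p" using is_scycleD extend_nz by blast+
  show "scycle w p = scycle v p \<union> {q, - q}"
  proof (rule set_eqI)
    fix y
    have "y \<in> scycle w p \<longleftrightarrow> (\<exists>j<Suc (slen v p). \<bar>y\<bar> = \<bar>(w ^^ j) p\<bar>)"
      by (simp add: scycle_iff *)
    also have "\<dots> \<longleftrightarrow> \<bar>y\<bar> = \<bar>p\<bar> \<or> (\<exists>j<slen v p. \<bar>y\<bar> = \<bar>(w ^^ Suc j) p\<bar>)"
      by (subst Ex_less_Suc2) simp
    \<comment> \<open>Time 0 gives p for both permutations and time 1 of w gives q; only the later
      times are matched by the delay.\<close>
    also have "\<dots> \<longleftrightarrow> \<bar>y\<bar> = \<bar>q\<bar> \<or> (\<exists>j<slen v p. \<bar>y\<bar> = \<bar>(v ^^ j) p\<bar>)"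
    proof -
      obtain L where L: "slen v p = Suc L" using funpow_slen(1)[OF v extend_finite(2), of p] gr0_implies_Suc by blast
      have "(\<exists>j<L. \<bar>y\<bar> = \<bar>(w ^^ Suc (Suc j)) p\<bar>) \<longleftrightarrow> (\<exists>j<L. \<bar>y\<bar> = \<bar>(v ^^ Suc j) p\<bar>)"
        using fp[of "Suc _"] L by (metis Suc_leI Suc_mono zero_less_Suc less_imp_le)
      then show ?thesis unfolding L Ex_less_Suc2 using extend_at by auto
    qed
    also have "\<dots> \<longleftrightarrow> y \<in> scycle v p \<union> {q, - q}"
      by (auto simp: scycle_iff abs_eq_iff)
    finally show "y \<in> scycle w p \<longleftrightarrow> y \<in> scycle v p \<union> {q, - q}" .
  qed
qed

end

section \<open>Recursion for weighted sums over signed permutations\<close>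

definition sperm_total :: "(nat \<Rightarrow> Z2 \<Rightarrow> 'r::comm_ring_1) \<Rightarrow> int set \<Rightarrow> 'r" where
  "sperm_total g A = (\<Sum>w\<in>signed_perms A. \<Prod>x | x \<in> A \<and> x > 0. g (slen w x) (scls w x))"

text \<open>
  The cycle of \<open>p\<close> is weighted as if it were longer by \<open>i\<close>, so that deleting the successor of \<open>p\<close>
  from its cycle leaves a sum of the same kind.
\<close>

definition sperm_boosted :: "(nat \<Rightarrow> Z2 \<Rightarrow> 'r::comm_ring_1) \<Rightarrow> int set \<Rightarrow> int \<Rightarrow> nat \<Rightarrow> 'r" where
  "sperm_boosted g A p i = (\<Sum>w\<in>signed_perms A. g (slen w p + i) (scls w p) ^ (slen w p + i) *
     (\<Prod>x | x \<in> A - scycle w p \<and> x > 0. g (slen w x) (scls w x)))"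

text \<open>The weight is constant on the signed cycle of p, which has \<open>slen w p\<close>
  positive points, so their contribution splits off as a power.\<close>

lemma sperm_total_eq_boosted:
  assumes A: "symmetric_set A" and p: "p \<in> A"
  shows "sperm_total g A = sperm_boosted g A p 0"
  unfolding sperm_total_def sperm_boosted_def
proof (rule sum.cong[OF refl])
  fix w assume w: "w \<in> signed_perms A"
  have fin: "finite A" "p \<noteq> 0" using A p by (auto simp: symmetric_set_def)
  let ?g = "\<lambda>x. g (slen w x) (scls w x)"
  have sub: "scycle w p \<subseteq> A" by (rule scycle_subset[OF w A p])
  have "{x. x \<in> A \<and> x > 0} = {x \<in> scycle w p. x > 0} \<union> {x. x \<in> A - scycle w p \<and> x > 0}"
    using sub by auto
  then have "prod ?g {x. x \<in> A \<and> x > 0}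
      = prod ?g {x \<in> scycle w p. x > 0} * prod ?g {x. x \<in> A - scycle w p \<and> x > 0}"
    using fin sub finite_subset[OF sub fin(1)] by (simp only:) (rule prod.union_disjoint, auto)
  also have "prod ?g {x \<in> scycle w p. x > 0} = (\<Prod>x | x \<in> scycle w p \<and> x > 0. ?g p)"
    using scycle_invariant[OF w fin] by (intro prod.cong) auto
  also have "\<dots> = ?g p ^ slen w p" using scycle_positive[OF w fin] by simp
  finally show "prod ?g {x. x \<in> A \<and> x > 0} = g (slen w p + 0) (scls w p) ^ (slen w p + 0) *
      prod ?g {x. x \<in> A - scycle w p \<and> x > 0}" by simp
qed

text \<open>Split by q = w p. If q = \<open>act e p\<close>, the cycle of p has length 1 and class
  e, and the rest is an arbitrary signed permutation of the remaining points. Otherwise removing q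
  shortens the cycle of p by one and keeps its class; the boost \<open>Suc i\<close> compensates for
  the lost point.\<close>

lemma sperm_boosted_rec:
  assumes A: "symmetric_set A" and p: "p \<in> A"
  shows "sperm_boosted g A p i
    = (g (Suc i) 1 ^ Suc i + g (Suc i) (- 1) ^ Suc i) * sperm_total g (A - {p, - p})
      + (\<Sum>q\<in>A - {p, - p}. sperm_boosted g (A - {q, - q}) p (Suc i))"
proof -
  have fin: "finite A" "p \<noteq> 0" "- p \<in> A"
    using A p symmetric_set_uminus[OF A] by (auto simp: symmetric_set_def)
  define f where "f w = g (slen w p + i) (scls w p) ^ (slen w p + i) *
     (\<Prod>x | x \<in> A - scycle w p \<and> x > 0. g (slen w x) (scls w x))" for w
  define F where "F q = (\<Sum>v\<in>signed_perms (A - {q, - q}). f (v \<circ> stransp p q))" for q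
  have rest: "(\<Prod>x | x \<in> A - scycle (v \<circ> stransp p q) p \<and> x > 0.
        g (slen (v \<circ> stransp p q) x) (scls (v \<circ> stransp p q) x))
      = (\<Prod>x | x \<in> A - scycle (v \<circ> stransp p q) p \<and> x > 0. g (slen v x) (scls v x))"
    if "v \<in> signed_perms (A - {q, - q})" "q \<in> A" for v q
    using extend_other[OF A p that(2,1)] by (intro prod.cong) auto
  have fixed: "F (act e p) = g (Suc i) e ^ Suc i * sperm_total g (A - {p, - p})" for e
  proof -
    have q: "act e p \<in> A" and *: "{act e p, - act e p} = {p, - p}"
      using p fin by (auto simp: act_def)
    show ?thesis
      unfolding F_def sperm_total_def sum_distrib_left * f_def
    proof (rule sum.cong[OF refl])
      fix v assume "v \<in> signed_perms (A - {p, - p})"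
      then have v: "v \<in> signed_perms (A - {act e p, - act e p})" by (simp only: *)
      show "g (slen (v \<circ> stransp p (act e p)) p + i) (scls (v \<circ> stransp p (act e p)) p)
            ^ (slen (v \<circ> stransp p (act e p)) p + i) *
          (\<Prod>x | x \<in> A - scycle (v \<circ> stransp p (act e p)) p \<and> x > 0.
            g (slen (v \<circ> stransp p (act e p)) x) (scls (v \<circ> stransp p (act e p)) x))
        = g (Suc i) e ^ Suc i * (\<Prod>x | x \<in> A - {p, - p} \<and> x > 0. g (slen v x) (scls v x))"
        unfolding rest[OF v q] unfolding extend_fixed[OF A p q v refl] * by simp
    qed
  qed
  have ins: "F q = sperm_boosted g (A - {q, - q}) p (Suc i)" if q: "q \<in> A - {p, - p}" for q
  proof -
    have ne: "\<bar>q\<bar> \<noteq> \<bar>p\<bar>" and qA: "q \<in> A" using q by (auto simp: abs_eq_iff)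
    show ?thesis
      unfolding F_def sperm_boosted_def f_def
    proof (rule sum.cong[OF refl])
      fix v assume v: "v \<in> signed_perms (A - {q, - q})"
      have *: "A - (scycle v p \<union> {q, - q}) = A - {q, - q} - scycle v p" by auto
      show "g (slen (v \<circ> stransp p q) p + i) (scls (v \<circ> stransp p q) p)
            ^ (slen (v \<circ> stransp p q) p + i) *
          (\<Prod>x | x \<in> A - scycle (v \<circ> stransp p q) p \<and> x > 0.
            g (slen (v \<circ> stransp p q) x) (scls (v \<circ> stransp p q) x))
        = g (slen v p + Suc i) (scls v p) ^ (slen v p + Suc i) *
          (\<Prod>x | x \<in> A - {q, - q} - scycle v p \<and> x > 0. g (slen v x) (scls v x))"
        unfolding rest[OF v qA] unfolding extend_insert[OF A p qA v ne] * by simp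
    qed
  qed
  have "sperm_boosted g A p i = sum F A"
    unfolding sperm_boosted_def f_def[symmetric] F_def by (rule sum_signed_perms_split[OF A p])
  also have "\<dots> = sum F {p, - p} + sum F (A - {p, - p})"
    using sum.subset_diff[of "{p, - p}" A F] fin p by (simp add: add.commute)
  also have "sum F {p, - p} = F (act 1 p) + F (act (- 1) p)" using fin by simp
  also have "sum F (A - {p, - p}) = (\<Sum>q\<in>A - {p, - p}. sperm_boosted g (A - {q, - q}) p (Suc i))"
    by (rule sum.cong) (simp_all add: ins)
  finally show ?thesis by (simp only: fixed distrib_right)
qed

text \<open>Unfolding the cycle of p point by point requires a simultaneous induction with the
  boosted sums, over all symmetric sets of the given size and all p and i.\<close>

lemma sperm_total_eq:
  fixes g :: "nat \<Rightarrow> Z2 \<Rightarrow> 'r::comm_ring_1"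
  assumes Z0: "Z 0 = 1"
    and rec: "\<And>n. of_nat (2 * n) * Z n = (\<Sum>l=1..n. (g l 1 ^ l + g l (- 1) ^ l) * Z (n - l))"
    and A: "symmetric_set A" "card A = 2 * n"
  shows "sperm_total g A = of_nat (2 ^ n * fact n) * Z n"
proof -
  define S where "S l = g l 1 ^ l + g l (- 1) ^ l" for l
  \<comment> \<open>The value expected of the boosted sum on a set with \<open>2 * Suc n\<close>
    elements, up to the factor 2^n n!. The index l is the length of the cycle of p, and i shifts
    only the weight of that cycle.\<close>
  define Y where "Y n i = (\<Sum>l=1..Suc n. S (l + i) * Z (Suc n - l))" for n i
  have Y_Suc: "Y (Suc n) i = S (Suc i) * Z (Suc n) + Y n (Suc i)" for n i
    unfolding Y_def by (subst sum.atLeast_Suc_atMost) (simp_all only: sum.shift_bounds_cl_Suc_ivl, simp_all)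
  have card_rem: "card (B - {q, - q}) = 2 * n" if "symmetric_set B" "card B = 2 * Suc n" "q \<in> B" for B q n
  proof -
    have "finite B" "q \<noteq> 0" "- q \<in> B"
      using that symmetric_set_uminus[of B q] by (auto simp: symmetric_set_def)
    then show ?thesis using that by (subst card_Diff_subset) auto
  qed
  have "(\<forall>A. symmetric_set A \<and> card A = 2 * n \<longrightarrow> sperm_total g A = of_nat (2 ^ n * fact n) * Z n) \<and>
    (\<forall>A p i. symmetric_set A \<and> card A = 2 * Suc n \<and> p \<in> A \<longrightarrow>
      sperm_boosted g A p i = of_nat (2 ^ n * fact n) * Y n i)" for n
  proof (induction n)
    case 0
    have empty: "A = {}" if "symmetric_set A" "card A = 0" for A
      using that by (auto simp: symmetric_set_def)
    have "signed_perms {} = {id}" by (auto simp: signed_perms_def)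
    then have [simp]: "sperm_total g {} = 1" by (simp add: sperm_total_def)
    have "sperm_boosted g A p i = Y 0 i" if "symmetric_set A" "card A = 2" "p \<in> A" for A p i
    proof -
      have empty': "A - {p, - p} = {}"
        using that by (intro empty symmetric_set_Diff) (simp_all add: card_rem[of A 0])
      then show ?thesis
        by (simp only: sperm_boosted_rec[OF that(1,3)] empty') (simp add: Y_def S_def Z0)
    qed
    then show ?case by (auto simp: Z0 dest: empty)
  next
    case (Suc n)
    have tot: "sperm_total g A = of_nat (2 ^ Suc n * fact (Suc n)) * Z (Suc n)"
      if A: "symmetric_set A" "card A = 2 * Suc n" for A
    proof -
      obtain p where p: "p \<in> A" using A(2) by fastforce
      have "sperm_total g A = of_nat (2 ^ n * fact n) * Y n 0"
        using Suc A p by (simp add: sperm_total_eq_boosted[OF A(1) p])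
      \<comment> \<open>Without a boost, Y is the right-hand side of \<open>rec\<close>, whose
        factor 2 (n + 1) turns 2^n n! into the next normalisation.\<close>
      also have "Y n 0 = of_nat (2 * Suc n) * Z (Suc n)"
        unfolding rec Y_def S_def by simp
      finally show ?thesis by (simp add: algebra_simps)
    qed
    moreover have "sperm_boosted g A p i = of_nat (2 ^ Suc n * fact (Suc n)) * Y (Suc n) i"
      if A: "symmetric_set A" "card A = 2 * Suc (Suc n)" and p: "p \<in> A" for A p i
    proof -
      have "sperm_boosted g (A - {q, - q}) p (Suc i) = of_nat (2 ^ n * fact n) * Y n (Suc i)"
        if "q \<in> A - {p, - p}" for q
        using Suc card_rem[OF A, of q] symmetric_set_Diff[OF A(1), of q] that p by auto
      \<comment> \<open>All 2 (n + 1) choices of q contribute equally, and their number again raises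
        2^n n! to 2^(n + 1) (n + 1)!.\<close>
      then have "(\<Sum>q\<in>A - {p, - p}. sperm_boosted g (A - {q, - q}) p (Suc i))
          = of_nat (2 * Suc n) * (of_nat (2 ^ n * fact n) * Y n (Suc i))"
        using card_rem[OF A p] by simp
      moreover have "sperm_total g (A - {p, - p}) = of_nat (2 ^ Suc n * fact (Suc n)) * Z (Suc n)"
        by (rule tot[OF symmetric_set_Diff[OF A(1)] card_rem[OF A p]])
      ultimately show ?thesis
        by (simp only: sperm_boosted_rec[OF A(1) p] Y_Suc S_def) (simp add: algebra_simps)
    qed
    ultimately show ?case by blast
  qed
  then show ?thesis using A by blast
qed

section \<open>Cycle types and powers\<close>

lemma orbit_eq_of_mem:
  assumes "permutation f" "y \<in> orbit f x" shows "orbit f y = orbit f x"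
  using assms orbit_cyclic_eq3[OF cyclic_on_orbit'] by metis

lemma scycle_eq_orbit:
  assumes "w \<in> signed_perms A" "finite A"
  shows "scycle w x = orbit w x \<union> uminus ` orbit w x"
proof -
  have "permutation w" using assms by (auto simp: signed_perms_def permutation_permutes)
  then have "orbit w x = {(w ^^ m) x | m. True}" by (rule orbit_altdef_permutation)
  then show ?thesis
    by (auto simp: set_eq_iff scycle_alt[OF assms] abs_eq_iff image_iff minus_equation_iff[of _ "_"])
qed

lemma orbit_uminus:
  assumes "w \<in> signed_perms A" shows "orbit w (- x) = uminus ` orbit w x"
  by (auto simp: orbit_altdef signed_perms_funpow_uminus[OF assms])

text \<open>If - x were an iterate, its time would be a multiple of \<open>slen w x\<close>, at
  which class 1 returns x itself. So the cycle differs from its negative, and its period without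
  signs is \<open>slen w x\<close>.\<close>

lemma orbit_positive_class:
  assumes "w \<in> signed_perms A" "finite A" "x \<noteq> 0" "scls w x = 1"
  shows "orbit w x \<noteq> uminus ` orbit w x" "card (orbit w x) = slen w x"
proof -
  have per: "(w ^^ (slen w x * a)) x = x" for a
    by (simp add: funpow_slen_mult[OF assms(1,2)] assms(4))
  have "permutation w" using assms by (auto simp: signed_perms_def permutation_permutes)
  then have orb: "orbit w x = {(w ^^ m) x | m. True}" by (rule orbit_altdef_permutation)
  have "- x \<noteq> (w ^^ m) x" for m
  proof
    assume m: "- x = (w ^^ m) x"
    then have "slen w x dvd m"
      unfolding abs_funpow_eq_self_iff[OF assms(1,2), symmetric] by (metis abs_minus_cancel)
    then have "(w ^^ m) x = x" using per by (auto elim: dvdE)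
    then show False using m assms(3) by simp
  qed
  then have "- x \<notin> orbit w x" by (auto simp: orb)
  moreover have "x \<in> orbit w x" unfolding orb by (metis (mono_tags) funpow_0 mem_Collect_eq)
  ultimately show "orbit w x \<noteq> uminus ` orbit w x" by (metis imageI)
  have "(w ^^ m) x = (w ^^ (m mod slen w x)) x" for m
  proof -
    have "(w ^^ (m mod slen w x + slen w x * (m div slen w x))) x = (w ^^ (m mod slen w x)) x"
      unfolding funpow_add by (simp add: per)
    then show ?thesis by simp
  qed
  then have "orbit w x = (\<lambda>j. (w ^^ j) x) ` {..<slen w x}"
    unfolding orb using funpow_slen(1)[OF assms(1,2), of x]
    by (fastforce simp: image_iff intro: mod_less_divisor)
  moreover have "inj_on (\<lambda>j. (w ^^ j) x) {..<slen w x}"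
    using inj_on_abs_funpow[OF assms(1,2), of x] by (auto simp: inj_on_def)
  ultimately show "card (orbit w x) = slen w x" by (simp add: card_image)
qed

text \<open>The iterate at time \<open>slen w x\<close> is - x, so the cycle absorbs its negative
  and coincides with the signed cycle, half of whose entries are positive.\<close>

lemma orbit_negative_class:
  assumes "w \<in> signed_perms A" "symmetric_set A" "x \<in> A" "scls w x = - 1"
  shows "orbit w x = uminus ` orbit w x" "card (orbit w x) = 2 * slen w x"
proof -
  have fin: "finite A" "x \<noteq> 0" using assms by (auto simp: symmetric_set_def)
  have perm: "permutation w" using assms fin by (auto simp: signed_perms_def permutation_permutes)
  then have orb: "orbit w x = {(w ^^ m) x | m. True}" by (rule orbit_altdef_permutation)
  have "- x \<in> orbit w x"
    unfolding orb using funpow_slen(2)[OF assms(1) fin(1), of x] assms(4)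
    by (auto simp: act_def intro: exI[of _ "slen w x"])
  then show *: "orbit w x = uminus ` orbit w x"
    using orbit_eq_of_mem[OF perm] orbit_uminus[OF assms(1)] by metis
  have **: "orbit w x = scycle w x"
    unfolding scycle_eq_orbit[OF assms(1) fin(1)] using * by auto
  have sub: "scycle w x \<subseteq> A" by (rule scycle_subset[OF assms(1,2,3)])
  have "symmetric_set (scycle w x)"
    using * sub assms(2) finite_subset[OF sub fin(1)] unfolding ** by (auto simp: symmetric_set_def)
  then show "card (orbit w x) = 2 * slen w x"
    unfolding ** by (simp add: card_symmetric_set scycle_positive[OF assms(1) fin])
qed

section \<open>The hyperoctahedral group and its order\<close>

lemma finite_pm_set: "finite (pm_set n)"
  by (simp add: pm_set_def)

lemma symmetric_pm_set: "symmetric_set (pm_set n)"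
proof -
  have "x \<in> uminus ` pm_set n" if "x \<in> pm_set n" for x
    using that by (intro image_eqI[of _ _ "- x"]) (auto simp: pm_set_def)
  moreover have "uminus ` pm_set n \<subseteq> pm_set n" "finite (pm_set n)" "0 \<notin> pm_set n"
    by (auto simp: pm_set_def)
  ultimately show ?thesis unfolding symmetric_set_def by blast
qed

lemma pm_set_positive: "{x. x \<in> pm_set n \<and> x > 0} = {1..int n}"
  by (auto simp: pm_set_def)

lemma card_pm_set: "card (pm_set n) = 2 * n"
  using card_symmetric_set[OF symmetric_pm_set, of n] pm_set_positive[of n] by simp

lemma hyperoct_eq: "hyperoct n = signed_perms (pm_set n)"
proof -
  have "w (- x) = - w x" if "w permutes pm_set n" "\<forall>i\<in>pm_set n. w (- i) = - w i" for w x
    using that symmetric_set_uminus[OF symmetric_pm_set, of x n]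
    by (cases "x \<in> pm_set n") (auto simp: permutes_not_in)
  then show ?thesis by (auto simp: hyperoct_def signed_perms_def)
qed

text \<open>With all weights equal to 1 the recursion is solved by Z = 1, since it then reads 2 n =
  2 + ... + 2 with n summands.\<close>

lemma card_hyperoct: "card (hyperoct n) = 2 ^ n * fact n"
proof -
  have "int (card (hyperoct n)) = sperm_total (\<lambda>_ _. 1) (pm_set n)"
    by (simp add: sperm_total_def hyperoct_eq)
  also have "\<dots> = of_nat (2 ^ n * fact n) * 1"
    by (rule sperm_total_eq[where Z = "\<lambda>_. 1"]) (simp_all add: symmetric_pm_set card_pm_set)
  finally show ?thesis by (metis mult.right_neutral of_nat_eq_iff)
qed

text \<open>Let a and b be the quotients of \<open>slen w x\<close> and k by their gcd. A return up
  to sign under \<open>w ^^ k\<close> at time j means that \<open>slen w x\<close> divides k * j,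
  that is, a divides j. At time a the signed cycle of w has been traversed b times, whence the
  exponent of the class.\<close>

lemma slen_power:
  assumes "w \<in> signed_perms A" "finite A" "x \<noteq> 0" "k > 0"
  shows "slen (w ^^ k) x = slen w x div gcd (slen w x) k"
    "scls (w ^^ k) x = scls w x ^ (k div gcd (slen w x) k)"
proof -
  let ?L = "slen w x"
  define g where "g = gcd ?L k"
  have L: "?L > 0" by (rule funpow_slen(1)[OF assms(1,2)])
  have "g dvd ?L" "g dvd k" "g > 0" using L by (simp_all add: g_def)
  then obtain a b where a: "?L = g * a" and b: "k = g * b" by (auto elim!: dvdE)
  have "g * gcd a b = g"
    unfolding gcd_mult_distrib_nat a[symmetric] b[symmetric] by (rule g_def[symmetric])
  then have "gcd a b = 1" using \<open>g > 0\<close> by simp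
  then have ab: "a > 0" "coprime a b"
    using L a by (auto simp: coprime_iff_gcd_eq_1 intro: gr0I)
  have fp: "((w ^^ k) ^^ j) x = (w ^^ (k * j)) x" for j by (simp add: funpow_mult)
  have "is_scycle (w ^^ k) x a (scls w x ^ b)"
    unfolding is_scycle_def fp
  proof (intro conjI allI impI)
    have "k * a = ?L * b" using a b by simp
    then show "(w ^^ (k * a)) x = act (scls w x ^ b) x"
      by (simp only: funpow_slen_mult[OF assms(1,2)])
    fix j assume j: "0 < j \<and> j < a"
    show "\<bar>(w ^^ (k * j)) x\<bar> \<noteq> \<bar>x\<bar>"
    proof
      assume "\<bar>(w ^^ (k * j)) x\<bar> = \<bar>x\<bar>"
      then have "g * a dvd g * (b * j)"
        unfolding abs_funpow_eq_self_iff[OF assms(1,2)] a[symmetric] b by (simp add: mult.assoc)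
      then have "a dvd b * j" using \<open>g > 0\<close> by simp
      then have "a dvd j" using ab(2) coprime_dvd_mult_right_iff by blast
      then show False using j by (auto dest: dvd_imp_le)
    qed
  qed (rule ab)
  moreover have "?L div g = a" "k div g = b" using a b \<open>g > 0\<close> by simp_all
  ultimately show "slen (w ^^ k) x = ?L div gcd ?L k" "scls (w ^^ k) x = scls w x ^ (k div gcd ?L k)"
    using is_scycleD[OF _ assms(3)] unfolding g_def by blast+
qed

section \<open>Cycle numbers as counts of positive points\<close>

definition typed_points :: "nat \<Rightarrow> (int \<Rightarrow> int) \<Rightarrow> nat \<Rightarrow> Z2 \<Rightarrow> int set" where
  "typed_points n w l e = {i \<in> {1..int n}. slen w i = l \<and> scls w i = e}"

lemma pm_set_pos_subset: "i \<in> {1..int n} \<Longrightarrow> i \<in> pm_set n"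
  by (auto simp: pm_set_def)

text \<open>The unordered pair of a cycle and its negative identifies a signed cycle in both
  classes. In class - 1 it is a singleton from which the cycle is recovered, which matches the other
  branch of \<open>num_cycles\<close>. Positive points reach every pair because x and - x give the
  same one.\<close>

lemma num_cycles_eq_card_image:
  assumes "w \<in> hyperoct n"
  shows "num_cycles n w l e = card ((\<lambda>i. {orbit w i, uminus ` orbit w i}) ` typed_points n w l e)"
proof -
  have w: "w \<in> signed_perms (pm_set n)" using assms by (simp add: hyperoct_eq)
  note fin = finite_pm_set[of n]
  let ?c = "\<lambda>i. {orbit w i, uminus ` orbit w i}"
  let ?P = "\<lambda>c. if e = 1 then c \<noteq> uminus ` c \<and> card c = l else c = uminus ` c \<and> card c = 2 * l"
  have typed: "?P (orbit w i) \<longleftrightarrow> slen w i = l \<and> scls w i = e" if "i \<in> {1..int n}" for i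
  proof -
    have i: "i \<in> pm_set n" "i \<noteq> 0" using that by (auto simp: pm_set_def)
    show ?thesis
      using Z2_cases[of e] Z2_cases[of "scls w i"] orbit_positive_class[OF w fin i(2)]
        orbit_negative_class[OF w symmetric_pm_set i(1)]
      by auto
  qed
  have neg: "?P (uminus ` c) \<longleftrightarrow> ?P c" for c :: "int set"
  proof -
    have "uminus ` uminus ` c = c" by (simp add: image_image)
    moreover have "card (uminus ` c) = card c" by (rule card_image) simp
    ultimately show ?thesis by auto
  qed
  have img: "?c ` typed_points n w l e = (\<lambda>c. {c, uminus ` c}) ` {c \<in> cycles_of n w. ?P c}"
  proof (intro equalityI subsetI)
    fix s assume "s \<in> ?c ` typed_points n w l e"
    then obtain i where i: "i \<in> {1..int n}" "slen w i = l \<and> scls w i = e" "s = ?c i"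
      by (auto simp: typed_points_def)
    then have "orbit w i \<in> {c \<in> cycles_of n w. ?P c}"
      using typed[OF i(1)] pm_set_pos_subset[OF i(1)] unfolding cycles_of_def by blast
    then show "s \<in> (\<lambda>c. {c, uminus ` c}) ` {c \<in> cycles_of n w. ?P c}" using i(3) by blast
  next
    fix s assume "s \<in> (\<lambda>c. {c, uminus ` c}) ` {c \<in> cycles_of n w. ?P c}"
    then obtain x where x: "x \<in> pm_set n" "?P (orbit w x)" "s = ?c x"
      unfolding cycles_of_def by blast
    have i: "\<bar>x\<bar> \<in> {1..int n}" using x(1) by (auto simp: pm_set_def)
    have orb: "orbit w x = orbit w \<bar>x\<bar> \<or> orbit w x = uminus ` orbit w \<bar>x\<bar>"
      using orbit_uminus[OF w, of "\<bar>x\<bar>"] by (cases "x \<ge> 0") auto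
    then have "?P (orbit w \<bar>x\<bar>)" using x(2) neg by metis
    then have "\<bar>x\<bar> \<in> typed_points n w l e" using typed[OF i] i by (simp add: typed_points_def)
    moreover have "s = ?c \<bar>x\<bar>" using orb x(3) by (auto simp: image_image)
    ultimately show "s \<in> ?c ` typed_points n w l e" by blast
  qed
  show ?thesis
  proof (cases "e = 1")
    case True
    then show ?thesis unfolding img num_cycles_def by (auto intro!: arg_cong[of _ _ card])
  next
    case False
    then have "inj_on (\<lambda>c. {c, uminus ` c}) {c \<in> cycles_of n w. ?P c}"
      by (auto simp: inj_on_def)
    then show ?thesis unfolding img card_image using False by (simp add: num_cycles_def card_image)
  qed
qed

text \<open>The fibre over a pair consists of the positive points of its signed cycle, and there are
  l of them.\<close>

lemma num_cycles_card:
  assumes "w \<in> hyperoct n"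
  shows "l * num_cycles n w l e = card (typed_points n w l e)"
proof -
  have w: "w \<in> signed_perms (pm_set n)" using assms by (simp add: hyperoct_eq)
  note fin = finite_pm_set[of n]
  have perm: "permutation w" using w fin by (auto simp: signed_perms_def permutation_permutes)
  let ?c = "\<lambda>i. {orbit w i, uminus ` orbit w i}"
  let ?I = "typed_points n w l e"
  have finI: "finite ?I"
    by (rule finite_subset[of _ "{1..int n}"]) (auto simp: typed_points_def)
  have fibre: "card {j \<in> ?I. ?c j = ?c i} = l" if i: "i \<in> ?I" for i
  proof -
    have i': "i \<in> pm_set n" "i \<noteq> 0" "slen w i = l" "scls w i = e"
      using i by (auto simp: typed_points_def pm_set_def)
    have "{j \<in> ?I. ?c j = ?c i} = {y \<in> scycle w i. y > 0}"
    proof (intro equalityI subsetI)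
      fix j assume j: "j \<in> {j \<in> ?I. ?c j = ?c i}"
      have "scycle w x = \<Union> (?c x)" for x by (simp add: scycle_eq_orbit[OF w fin])
      moreover have "?c j = ?c i" using j by blast
      ultimately have "scycle w j = scycle w i" by (simp only:)
      moreover have "j \<in> scycle w j" by (rule scycle_closed[OF w fin, of 0 _ 0]) simp
      ultimately show "j \<in> {y \<in> scycle w i. y > 0}" using j by (auto simp: typed_points_def)
    next
      fix y assume y: "y \<in> {y \<in> scycle w i. y > 0}"
      then have "y \<in> orbit w i \<or> - y \<in> orbit w i"
        by (auto simp: scycle_eq_orbit[OF w fin])
      then have "?c y = ?c i"
      proof
        assume "y \<in> orbit w i"
        then show ?thesis using orbit_eq_of_mem[OF perm, of y i] by (simp only:)
      next
        assume "- y \<in> orbit w i"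
        then have "orbit w (- y) = orbit w i" by (rule orbit_eq_of_mem[OF perm])
        moreover have "orbit w y = uminus ` orbit w (- y)"
          using orbit_uminus[OF w, of "- y"] by (simp only: minus_minus)
        ultimately have *: "orbit w y = uminus ` orbit w i" by (simp only:)
        have "uminus ` uminus ` orbit w i = orbit w i" by (simp add: image_image)
        then show ?thesis unfolding * by blast
      qed
      moreover have "y \<in> {1..int n}"
        using y scycle_subset[OF w symmetric_pm_set i'(1)] by (auto simp: pm_set_def)
      ultimately show "y \<in> {j \<in> ?I. ?c j = ?c i}"
        using y scycle_invariant[OF w fin i'(2)] i' by (auto simp: typed_points_def)
    qed
    then show ?thesis by (simp only: scycle_positive[OF w fin i'(2)] i'(3))
  qed
  have "card ?I = (\<Sum>s\<in>?c ` ?I. card {j \<in> ?I. ?c j = s})"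
    using sum.image_gen[OF finI, of "\<lambda>_. 1 :: nat" ?c] by simp
  also have "\<dots> = (\<Sum>s\<in>?c ` ?I. l)" by (rule sum.cong) (use fibre in auto)
  finally show ?thesis by (simp add: num_cycles_eq_card_image[OF assms])
qed

text \<open>The exponents count points, so the product over types is the product over points grouped
  by type; types without points have exponent 0.\<close>

lemma prod_any_cycles:
  fixes f :: "nat \<Rightarrow> Z2 \<Rightarrow> 'r::comm_ring_1"
  assumes "w \<in> hyperoct n"
  shows "(\<Prod>(l, e). f l e ^ (l * num_cycles n w l e)) = (\<Prod>i\<in>{1..int n}. f (slen w i) (scls w i))"
proof -
  let ?t = "\<lambda>i. (slen w i, scls w i)"
  have "(\<Prod>(l, e). f l e ^ (l * num_cycles n w l e))
      = (\<Prod>(l, e). f l e ^ card {i \<in> {1..int n}. ?t i = (l, e)})"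
    by (simp add: num_cycles_card[OF assms] typed_points_def)
  also have "\<dots> = (\<Prod>(l, e)\<in>?t ` {1..int n}. f l e ^ card {i \<in> {1..int n}. ?t i = (l, e)})"
  proof (rule Prod_any.expand_superset)
    show "{p. (case p of (l, e) \<Rightarrow> f l e ^ card {i \<in> {1..int n}. ?t i = (l, e)}) \<noteq> 1}
        \<subseteq> ?t ` {1..int n}"
    proof safe
      fix l e assume *: "f l e ^ card {i \<in> {1..int n}. ?t i = (l, e)} \<noteq> 1"
      then have "{i \<in> {1..int n}. ?t i = (l, e)} \<noteq> {}" by (metis card.empty power_0)
      then show "(l, e) \<in> ?t ` {1..int n}" by force
    qed
  qed simp
  also have "\<dots> = (\<Prod>p\<in>?t ` {1..int n}. \<Prod>i | i \<in> {1..int n} \<and> ?t i = p. f (slen w i) (scls w i))"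
  proof (rule prod.cong[OF refl], clarify)
    fix l e
    have "(\<Prod>i | i \<in> {1..int n} \<and> ?t i = (l, e). f (slen w i) (scls w i))
        = (\<Prod>i | i \<in> {1..int n} \<and> ?t i = (l, e). f l e)"
      by (rule prod.cong) auto
    then show "f l e ^ card {i \<in> {1..int n}. ?t i = (l, e)}
        = (\<Prod>i | i \<in> {1..int n} \<and> ?t i = (l, e). f (slen w i) (scls w i))" by simp
  qed
  also have "\<dots> = (\<Prod>i\<in>{1..int n}. f (slen w i) (scls w i))"
    by (rule prod.image_gen[symmetric]) simp
  finally show ?thesis .
qed

section \<open>Signed cycle types and sums over conjugacy classes\<close>

definition cycle_type :: "nat \<Rightarrow> (int \<Rightarrow> int) \<Rightarrow> Z2 \<Rightarrow> nat multiset" where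
  "cycle_type n w e = Abs_multiset (\<lambda>l. num_cycles n w l e)"

text \<open>Only lengths of cycles through 1, ..., n occur, so the multiplicities have the finite
  support that \<open>Abs_multiset\<close> requires.\<close>

lemma count_cycle_type:
  assumes "w \<in> hyperoct n"
  shows "count (cycle_type n w e) l = num_cycles n w l e"
proof -
  have "{l. 0 < num_cycles n w l e} \<subseteq> slen w ` {1..int n}"
  proof
    fix l assume "l \<in> {l. 0 < num_cycles n w l e}"
    then have "typed_points n w l e \<noteq> {}" by (auto simp: num_cycles_eq_card_image[OF assms])
    then show "l \<in> slen w ` {1..int n}" by (auto simp: typed_points_def)
  qed
  then have "finite {l. 0 < num_cycles n w l e}" by (rule finite_subset) simp
  then show ?thesis unfolding cycle_type_def by (simp add: Abs_multiset_inverse)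
qed

text \<open>A length times its multiplicity is the number of points of that type; summing over
  lengths and classes counts each of 1, ..., n once.\<close>

lemma cycle_type_bipartition:
  assumes "w \<in> hyperoct n"
  shows "cycle_type n w \<in> bipartitions n"
proof -
  have w: "w \<in> signed_perms (pm_set n)" using assms by (simp add: hyperoct_eq)
  note fin = finite_pm_set[of n]
  have "typed_points n w 0 e = {}" for e
    using funpow_slen(1)[OF w fin] by (auto simp: typed_points_def)
  then have 0: "0 \<notin># cycle_type n w e" for e
    by (simp add: count_cycle_type[OF assms] num_cycles_eq_card_image[OF assms] not_in_iff)
  have "\<Sum>\<^sub># (cycle_type n w e) = card {i \<in> {1..int n}. scls w i = e}" for e
  proof -
    let ?J = "{i \<in> {1..int n}. scls w i = e}"
    have finJ: "finite ?J" by (rule finite_subset[of _ "{1..int n}"]) auto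
    have pts: "typed_points n w l e = {i \<in> ?J. slen w i = l}" for l by (auto simp: typed_points_def)
    have "\<Sum>\<^sub># (cycle_type n w e) = (\<Sum>l\<in>set_mset (cycle_type n w e). card (typed_points n w l e))"
      by (simp add: sum_mset_eq_count[symmetric] count_cycle_type[OF assms] num_cycles_card[OF assms])
    also have "\<dots> = (\<Sum>l\<in>slen w ` ?J. card (typed_points n w l e))"
    proof (rule sum.mono_neutral_left)
      show "set_mset (cycle_type n w e) \<subseteq> slen w ` ?J"
      proof
        fix l assume "l \<in># cycle_type n w e"
        then have "typed_points n w l e \<noteq> {}"
          by (auto simp: count_cycle_type[OF assms] num_cycles_eq_card_image[OF assms]
              count_greater_zero_iff[symmetric] simp del: count_greater_zero_iff)
        then show "l \<in> slen w ` ?J" by (auto simp: typed_points_def)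
      qed
      show "\<forall>l\<in>slen w ` ?J - set_mset (cycle_type n w e). card (typed_points n w l e) = 0"
        by (simp add: num_cycles_card[OF assms, symmetric] count_cycle_type[OF assms, symmetric]
            count_eq_zero_iff)
      show "finite (slen w ` ?J)"
        using finJ by (rule finite_imageI)
    qed
    also have "\<dots> = card ?J"
      using sum.image_gen[OF finJ, of "\<lambda>_. 1 :: nat" "slen w"] by (simp add: pts)
    finally show ?thesis .
  qed
  then have "(\<Sum>e\<in>UNIV. \<Sum>\<^sub># (cycle_type n w e)) = (\<Sum>e\<in>UNIV. card {i \<in> {1..int n}. scls w i = e})"
    by simp
  also have "\<dots> = card {1..int n}"
    using sum.group[of "{1..int n}" UNIV "scls w" "\<lambda>_. 1 :: nat"] by simp
  finally show ?thesis using 0 by (simp add: bipartitions_def)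
qed

lemma conj_class_iff:
  "w \<in> conj_class n la \<longleftrightarrow> w \<in> hyperoct n \<and> cycle_type n w = la"
  by (auto simp: conj_class_def fun_eq_iff multiset_eq_iff count_cycle_type)

text \<open>Each element lies in the class of its own cycle type and in no other.\<close>

lemma sum_conj_classes:
  "(\<Sum>la\<in>bipartitions n. \<Sum>x | x \<in> conj_class n la \<and> P x. h x) = (\<Sum>x | x \<in> hyperoct n \<and> P x. h x)"
proof -
  have "{x. x \<in> conj_class n la \<and> P x} = {x \<in> {x. x \<in> hyperoct n \<and> P x}. cycle_type n x = la}" for la
    by (auto simp: conj_class_iff)
  then show ?thesis
    using sum.group[of "{x. x \<in> hyperoct n \<and> P x}" "bipartitions n" "cycle_type n" h]
      finite_hyperoct[of n] finite_bipartitions[of n] cycle_type_bipartition by auto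
qed

text \<open>As y is determined by x, the four sums collapse to one over x. The cycles of y are read
  off at the same points as those of x, so by \<open>slen_power\<close> both products merge into one
  weight per point.\<close>

lemma sum_root_pairs:
  fixes R T :: "nat \<Rightarrow> Z2 \<Rightarrow> rt_series"
  assumes "k > 0"
  shows "(\<Sum>mu\<in>bipartitions n. \<Sum>y\<in>conj_class n mu.
        \<Sum>la\<in>bipartitions n. \<Sum>x | x \<in> conj_class n la \<and> x ^^ k = y.
          (\<Prod>(l, e). R l e ^ (l * count (la e) l)) *
          (\<Prod>(j, th). T j th ^ (j * count (mu th) j)))
    = sperm_total (\<lambda>l e. R l e * T (l div gcd l k) (e ^ (k div gcd l k))) (pm_set n)"
proof -
  define h where "h x = (\<Prod>i\<in>{1..int n}. R (slen x i) (scls x i)) *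
    (\<Prod>i\<in>{1..int n}. T (slen (x ^^ k) i) (scls (x ^^ k) i))" for x
  have wt: "(\<Prod>(l, e). f l e ^ (l * count (la e) l)) = (\<Prod>i\<in>{1..int n}. f (slen x i) (scls x i))"
    if "x \<in> conj_class n la" for x la and f :: "nat \<Rightarrow> Z2 \<Rightarrow> rt_series"
    using that prod_any_cycles[of x n f] by (simp add: conj_class_def)
  have "(\<Sum>mu\<in>bipartitions n. \<Sum>y\<in>conj_class n mu.
        \<Sum>la\<in>bipartitions n. \<Sum>x | x \<in> conj_class n la \<and> x ^^ k = y.
          (\<Prod>(l, e). R l e ^ (l * count (la e) l)) *
          (\<Prod>(j, th). T j th ^ (j * count (mu th) j)))
    = (\<Sum>mu\<in>bipartitions n. \<Sum>y\<in>conj_class n mu.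
        \<Sum>la\<in>bipartitions n. \<Sum>x | x \<in> conj_class n la \<and> x ^^ k = y. h x)"
    by (intro sum.cong refl) (auto simp: wt h_def)
  also have "\<dots> = (\<Sum>y\<in>hyperoct n. \<Sum>x | x \<in> hyperoct n \<and> x ^^ k = y. h x)"
    using sum_conj_classes[where n = n and P = "\<lambda>_. True"
        and h = "\<lambda>y. \<Sum>x | x \<in> hyperoct n \<and> x ^^ k = y. h x"]
    by (simp add: sum_conj_classes)
  also have "\<dots> = (\<Sum>x\<in>hyperoct n. h x)"
    by (rule sum.group) (auto simp: finite_hyperoct, auto simp: hyperoct_eq signed_perms_funpow)
  also have "\<dots> = sperm_total (\<lambda>l e. R l e * T (l div gcd l k) (e ^ (k div gcd l k))) (pm_set n)"
    unfolding sperm_total_def pm_set_positive hyperoct_eq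
  proof (rule sum.cong[OF refl])
    fix x assume x: "x \<in> signed_perms (pm_set n)"
    have "finite (pm_set n)" by (simp add: pm_set_def)
    then show "h x = (\<Prod>i\<in>{1..int n}. R (slen x i) (scls x i) *
        T (slen x i div gcd (slen x i) k) (scls x i ^ (k div gcd (slen x i) k)))"
      unfolding h_def prod.distrib[symmetric]
      by (intro prod.cong refl) (simp add: slen_power[OF x _ _ assms])
  qed
  finally show ?thesis .
qed

section \<open>The cycle index and its generating function\<close>

fun cycle_index :: "(nat \<Rightarrow> ('v, 'a::field_char_0) mps) \<Rightarrow> nat \<Rightarrow> ('v, 'a) mps" where
  "cycle_index S n = (if n = 0 then 1
    else mps_const (1 / of_nat (2 * n)) * (\<Sum>l\<in>{1..n}. S l * cycle_index S (n - l)))"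

declare cycle_index.simps [simp del]

lemma of_nat_mult_const_inverse:
  assumes "n > 0"
  shows "of_nat n * (mps_const (1 / of_nat n) * f) = (f :: ('v, 'a::field_char_0) mps)"
  by (rule mps_eqI) (use assms in \<open>simp add: coeff_of_nat_mult coeff_const_mult\<close>)

lemma cycle_index_rec:
  "of_nat (2 * n) * cycle_index S n = (\<Sum>l=1..n. S l * cycle_index S (n - l))"
proof (cases "n = 0")
  case False
  then show ?thesis
    by (subst cycle_index.simps) (simp add: of_nat_mult_const_inverse del: of_nat_mult)
qed simp

lemma homogeneous_cycle_index:
  assumes "\<And>l. homogeneous (S l) (2 * l)"
  shows "homogeneous (cycle_index S n) (2 * n)"
proof (induction n rule: less_induct)
  case (less n)
  show ?case
  proof (cases "n = 0")
    case True
    then show ?thesis by (simp add: cycle_index.simps homogeneous_one)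
  next
    case False
    have "homogeneous (\<Sum>l\<in>{1..n}. S l * cycle_index S (n - l)) (2 * n)"
    proof (rule homogeneous_sum)
      fix l assume l: "l \<in> {1..n}"
      then have "homogeneous (S l * cycle_index S (n - l)) (2 * l + 2 * (n - l))"
        using False by (intro homogeneous_mult assms less) auto
      moreover have "2 * l + 2 * (n - l) = 2 * n" using l by (simp, linarith)
      ultimately show "homogeneous (S l * cycle_index S (n - l)) (2 * n)" by (simp only:)
    qed
    from homogeneous_mult[OF homogeneous_const this] show ?thesis
      using False by (subst cycle_index.simps) simp
  qed
qed

text \<open>The normalised sums coincide with \<open>cycle_index\<close>, which is defined by the
  recursion itself; the exponential formula then applies with degree 2 per point.\<close>

lemma hyperoct_cycle_index:
  fixes g :: "nat \<Rightarrow> Z2 \<Rightarrow> ('v, 'a::field_char_0) mps"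
  assumes g: "\<And>l e. homogeneous (g l e) 2"
  shows "mps_sum (\<lambda>n. mps_const (1 / of_nat (card (hyperoct n))) * sperm_total g (pm_set n)) UNIV
    = mps_exp (mps_sum (\<lambda>l. mps_const (1 / of_nat (2 * l)) * (g l 1 ^ l + g l (- 1) ^ l)) UNIV)"
proof -
  define S where "S l = g l 1 ^ l + g l (- 1) ^ l" for l
  \<comment> \<open>S 0 = 2 is replaced by 0 to meet the condition of \<open>mps_sum_eq_exp\<close>;
    the exponent keeps its value, because the factor 1 / 0 at l = 0 is 0.\<close>
  define G where "G l = (if l = 0 then 0 else S l)" for l
  have "homogeneous (g l e ^ l) (2 * l)" for l e
    using homogeneous_power[OF g, of l e l] by (simp add: mult.commute)
  then have S: "homogeneous (S l) (2 * l)" for l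
    unfolding S_def by (auto simp: homogeneous_def) (metis add.right_neutral)
  have "mps_const (1 / of_nat (card (hyperoct n))) * sperm_total g (pm_set n) = cycle_index S n" for n
  proof -
    have "sperm_total g (pm_set n) = of_nat (2 ^ n * fact n) * cycle_index S n"
      by (rule sperm_total_eq) (simp_all only: cycle_index_rec S_def symmetric_pm_set card_pm_set,
          simp add: cycle_index.simps)
    then show ?thesis
      using of_nat_mult_const_inverse[of "2 ^ n * fact n" "cycle_index S n"]
      by (simp only: card_hyperoct mult.left_commute) simp
  qed
  moreover have "mps_sum (cycle_index S) UNIV
      = mps_exp (mps_sum (\<lambda>l. mps_const (1 / of_nat (2 * l)) * G l) UNIV)"
  proof (rule mps_sum_eq_exp)
    show "homogeneous (cycle_index S n) (2 * n)" for n by (rule homogeneous_cycle_index[OF S])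
    show "homogeneous (G n) (2 * n)" for n using S[of n] by (auto simp: G_def homogeneous_def)
    show "of_nat (2 * n) * cycle_index S n = (\<Sum>l\<le>n. G l * cycle_index S (n - l))" for n
    proof -
      have "{..n} = insert 0 {1..n}" by auto
      then show ?thesis unfolding cycle_index_rec by (simp add: G_def)
    qed
  qed (simp_all add: cycle_index.simps G_def)
  moreover have "mps_const (1 / of_nat (2 * l)) * G l = mps_const (1 / of_nat (2 * l)) * S l" for l
    by (rule mps_eqI) (simp add: coeff_const_mult G_def)
  ultimately show ?thesis by (simp only: S_def)
qed

section \<open>Reindexing the exponent\<close>

lemma div_div_gcd:
  fixes k j h :: nat
  assumes "k > 0" "h dvd k" "gcd h j = 1"
  shows "gcd (j * k div h) k = k div h" "(j * k div h) div (k div h) = j" "k div (k div h) = h"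
proof -
  from assms(2) obtain k' where k: "k = h * k'" ..
  have pos: "h > 0" "k' > 0" using assms(1) k by auto
  then have 1: "j * k div h = j * k'" "k div h = k'" by (simp_all add: k)
  have "gcd (j * k') (h * k') = k'"
    using assms(3) by (simp add: gcd_mult_distrib_nat[symmetric] gcd.commute[of j h] mult.commute[of _ k'])
  then show "gcd (j * k div h) k = k div h" unfolding 1 by (simp only: k)
  show "(j * k div h) div (k div h) = j" unfolding 1 using pos by simp
  show "k div (k div h) = h" unfolding 1 using pos by (simp add: k)
qed

text \<open>With \<open>div_div_gcd\<close> and \<open>gcd_div_gcd\<close> this makes l \<mapsto> (l
  / gcd l k, k / gcd l k) a bijection from the positive l to the pairs (j, h) with j > 0, h dividing
  k and gcd h j = 1; its inverse is j k / h.\<close>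

lemma mult_div_gcd:
  fixes k l :: nat
  assumes "k > 0"
  shows "(l div gcd l k) * k div (k div gcd l k) = l"
proof -
  obtain a b where ab: "l = gcd l k * a" "k = gcd l k * b" by (meson dvdE gcd_dvd1 gcd_dvd2)
  define g where "g = gcd l k"
  have *: "l = g * a" "k = g * b" using ab by (simp_all add: g_def)
  have "g > 0" "b > 0" using assms * by auto
  then show ?thesis unfolding g_def[symmetric] by (simp add: *)
qed

lemma gcd_div_gcd:
  fixes k l :: nat
  assumes "k > 0"
  shows "gcd (k div gcd l k) (l div gcd l k) = 1"
  using div_gcd_coprime[of k l] assms unfolding gcd.commute[of l k] coprime_iff_gcd_eq_1 by simp

text \<open>Each positive l comes from exactly one pair j, h, and th is then forced to be
  \<open>e ^ h\<close>. The degree 2 * l of the summands confines the l relevant to a monomial to a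
  finite range; \<open>f0\<close> disposes of l = 0, which no pair produces.\<close>

lemma exponent_reindex:
  fixes f :: "nat \<Rightarrow> Z2 \<Rightarrow> nat \<Rightarrow> Z2 \<Rightarrow> rt_series"
  assumes k: "k > 0"
    and hom: "\<And>l e j th. homogeneous (f l e j th) (2 * l)"
    and f0: "\<And>e j th. f 0 e j th = 0"
  shows "mps_sum (\<lambda>(j, th). \<Sum>h | h dvd k \<and> gcd h j = 1. \<Sum>e\<in>root_signs h th. f (j * k div h) e j th)
      ({1..} \<times> UNIV)
    = mps_sum (\<lambda>l. \<Sum>e\<in>UNIV. f l e (l div gcd l k) (e ^ (k div gcd l k))) UNIV"
    (is "mps_sum ?F _ = mps_sum ?F' _")
proof (rule mps_eqI)
  fix m :: "indet \<Rightarrow>\<^sub>0 nat"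
  define N where "N = mdeg m"
  have large: "coeff (f l e j th) m = 0" if "l > N" for l e j th
    using hom[of l e j th] that by (auto simp: homogeneous_def N_def)
  have ge: "j \<le> j * k div h" if "h dvd k" for h j
    using that k by (auto elim!: dvdE)
  have div: "{h. h dvd k \<and> gcd h j = 1} \<subseteq> {..k}" for j
    using k by (auto dest: dvd_imp_le)
  define X where "X p = (SIGMA h:{h. h dvd k \<and> gcd h (fst p) = 1}. root_signs h (snd p))" for p :: "nat \<times> Z2"
  have finX: "finite (X p)" for p
    unfolding X_def using finite_subset[OF div] by (intro finite_SigmaI) auto
  have coeffF: "coeff (?F p) m = (\<Sum>(h, e)\<in>X p. coeff (f (fst p * k div h) e (fst p) (snd p)) m)" for p
    unfolding X_def using finite_subset[OF div]
    by (subst sum.Sigma[symmetric]) (auto simp: case_prod_unfold coeff_sum)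
  have "coeff (mps_sum ?F ({1..} \<times> UNIV)) m = (\<Sum>p\<in>{1..N} \<times> UNIV. coeff (?F p) m)"
  proof (rule coeff_mps_sum_superset)
    fix p :: "nat \<times> Z2" assume p: "p \<in> {1..} \<times> UNIV - {1..N} \<times> UNIV"
    then have "fst p > N" by (cases p) auto
    then have "fst p * k div h > N" if "h dvd k" for h using ge[OF that, of "fst p"] by simp
    then show "coeff (?F p) m = 0"
      unfolding coeffF by (intro sum.neutral) (auto simp: X_def large)
  qed auto
  also have "\<dots> = (\<Sum>(p, h, e)\<in>Sigma ({1..N} \<times> UNIV) X. coeff (f (fst p * k div h) e (fst p) (snd p)) m)"
    unfolding coeffF by (subst sum.Sigma) (auto simp: finX)
  \<comment> \<open>The bound j \<le> N still admits pairs with j k / h > N. Their terms vanish, and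
    without them the index set matches l \<le> N.\<close>
  also have "\<dots> = (\<Sum>(p, h, e)\<in>{(p, h, e) \<in> Sigma ({1..N} \<times> UNIV) X. fst p * k div h \<le> N}.
      coeff (f (fst p * k div h) e (fst p) (snd p)) m)"
    by (rule sum.mono_neutral_right) (auto simp: finX, metis large not_le)
  also have "\<dots> = (\<Sum>(l, e)\<in>{1..N} \<times> UNIV. coeff (f l e (l div gcd l k) (e ^ (k div gcd l k))) m)"
  proof (rule sum.reindex_bij_witness[of _
        "\<lambda>(l, e). ((l div gcd l k, e ^ (k div gcd l k)), (k div gcd l k, e))"
        "\<lambda>(p, h, e). (fst p * k div h, e)"], goal_cases)
    case (1 a)
    then show ?case by (auto simp: X_def root_signs_def div_div_gcd[OF k])
  next
    case (2 a)
    then show ?case using ge less_le_trans[OF _ ge] by (auto simp: X_def Suc_le_eq simp del: div_greater_zero_iff)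
  next
    case (3 b)
    then show ?case by (auto simp: mult_div_gcd[OF k])
  next
    case (4 b)
    have "Suc 0 \<le> x div gcd x k" "x div gcd x k \<le> N" "k div gcd x k dvd k" if "x \<ge> 1" "x \<le> N" for x
    proof -
      show "Suc 0 \<le> x div gcd x k" using that by (simp add: Suc_le_eq div_greater_zero_iff gcd_le1_nat)
      show "x div gcd x k \<le> N" using that(2) div_le_dividend le_trans by blast
      show "k div gcd x k dvd k" by (metis dvd_div_mult_self dvd_triv_left gcd_dvd2)
    qed
    with 4 show ?case
      by (auto simp: X_def root_signs_def mult_div_gcd[OF k] gcd_div_gcd[OF k, simplified])
  next
    case (5 a)
    then show ?case by (auto simp: X_def root_signs_def div_div_gcd[OF k])
  qed
  also have "\<dots> = (\<Sum>l\<in>{1..N}. coeff (?F' l) m)"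
    by (subst sum.Sigma[symmetric]) (auto simp: coeff_sum)
  also have "\<dots> = coeff (mps_sum ?F' UNIV) m"
  proof (rule coeff_mps_sum_superset[symmetric])
    fix l assume "l \<in> UNIV - {1..N}"
    then have "l = 0 \<or> l > N" by auto
    then show "coeff (?F' l) m = 0" by (auto simp: coeff_sum f0 large)
  qed auto
  finally show "coeff (mps_sum ?F ({1..} \<times> UNIV)) m = coeff (mps_sum ?F' UNIV) m" .
qed

section \<open>The generating function identity\<close>

theorem theorem3p6:
  fixes k :: nat
  assumes "k > 0"
  shows "mps_sum (\<lambda>n.
      mps_const (1 / of_nat (card (hyperoct n))) *
      (\<Sum>mu\<in>bipartitions n. \<Sum>y\<in>conj_class n mu.
        \<Sum>la\<in>bipartitions n. \<Sum>x | x \<in> conj_class n la \<and> x ^^ k = y.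
          (\<Prod>(l, e). r_var l e ^ (l * count (la e) l)) *
          (\<Prod>(j, th). t_var j th ^ (j * count (mu th) j)))) UNIV =
    mps_exp (mps_sum (\<lambda>(j, th).
      \<Sum>h | h dvd k \<and> gcd h j = 1.
        mps_const (1 / of_nat (2 * (j * k div h))) * t_var j th ^ (j * k div h) *
        (\<Sum>e\<in>root_signs h th. r_var (j * k div h) e ^ (j * k div h)))
      ({1..} \<times> UNIV))"
proof -
  \<comment> \<open>The weight of a point on a cycle of x of length l and class e; the second factor
    records the cycle of \<open>x ^^ k\<close> through that point.\<close>
  define g where "g l e = r_var l e * t_var (l div gcd l k) (e ^ (k div gcd l k))" for l e
  define f where "f l e j th = mps_const (1 / of_nat (2 * l)) * t_var j th ^ l * r_var l e ^ l"
    for l j :: nat and e th :: Z2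
  have var: "homogeneous (r_var l e) 1" "homogeneous (t_var l e) 1" for l e
    using homogeneous_var by (simp_all add: r_var_def t_var_def)
  have "homogeneous (g l e) 2" for l e
    using homogeneous_mult[OF var] by (simp add: g_def numeral_2_eq_2)
  have f: "homogeneous (f l e j th) (2 * l)" for l e j th
  proof -
    have "homogeneous (f l e j th) (0 + l * 1 + l * 1)"
      unfolding f_def by (intro homogeneous_mult homogeneous_const homogeneous_power var)
    moreover have "0 + l * 1 + l * 1 = 2 * l" by simp
    ultimately show ?thesis by (simp only:)
  qed
  \<comment> \<open>The leading constant is 1 / 0 = 0 here.\<close>
  have f0: "f 0 e j th = 0" for e j th
    by (rule mps_eqI) (simp add: f_def mps_const.rep_eq)
  have "mps_const (1 / of_nat (2 * l)) * (g l 1 ^ l + g l (- 1) ^ l)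
      = (\<Sum>e\<in>UNIV. f l e (l div gcd l k) (e ^ (k div gcd l k)))" for l
    by (simp add: UNIV_Z2 g_def f_def power_mult_distrib algebra_simps)
  then have "mps_sum (\<lambda>n. mps_const (1 / of_nat (card (hyperoct n))) * sperm_total g (pm_set n)) UNIV
      = mps_exp (mps_sum (\<lambda>(j, th). \<Sum>h | h dvd k \<and> gcd h j = 1.
          \<Sum>e\<in>root_signs h th. f (j * k div h) e j th) ({1..} \<times> UNIV))"
    using hyperoct_cycle_index[of g] \<open>\<And>l e. homogeneous (g l e) 2\<close>
    by (simp only: exponent_reindex[where f = f, OF assms f f0])
  then show ?thesis
    unfolding sum_root_pairs[OF assms] g_def f_def by (simp only: sum_distrib_left)
qed

end
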